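(* Let $\epsilon>0$ and $\eta=3^{3/2}2^{-1}$. The map sending $(a,b)\in\mathbf B_\epsilon$ to the coefficient $F_0$ of the unique sequence $F\in\ell^2(\mathbb Z)$ whose nonlinear Fourier series is $(a,b)$ is Lipschitz on $\mathbf B_\epsilon$ endowed with the metric induced by $\|(a,b)\|_{\mathcal H}=(\|a\|_{L^2(\mathbb T)}^2+\|b\|_{L^2(\mathbb T)}^2)^{1/2}$, with Lipschitz constant at most $(8+2^{5/2})(\eta\epsilon)^{-3/2}$.
   Context: $\mathbb T$ unit circle, $\mathbb D$ open unit disc, $\mathbb D^*=\{\overline z^{-1}:z\in\mathbb D\}\cup\{\infty\}$, $a^*(z)=\overline{a(\overline z^{-1})}$. $H^2(\mathbb D)$: functions in $L^2(\mathbb T)$ with vanishing negative Fourier coefficients; $H^2(\mathbb D^* )$: $f$ with $f^*\in H^2(\mathbb D)$, extended analytically to $\mathbb D^*$ with $f(\infty)=\overline{f^*(0)}$. Pairs multiply as $(a,b)(c,d)=(ac-bd^*,ad+bc^* )$. $\mathbf L$: pairs $(a,b)$ of measurable functions on $\mathbb T$ with $aa^*+bb^*=1$ a.e., $a\in H^2(\mathbb D^* )$, $a(\infty)>0$, with metric $\rho((a,b),(c,d))=\|a-c\|_{L^2}+\|b-d\|_{L^2}+|\log a(\infty)-\log c(\infty)|$. $\mathbf B$: $(a,b)\in\mathbf L$ with $\inf_{z\in\mathbb D^*}|a(z)|^2>\frac12$. $\mathbf B_\epsilon$: $(a,b)\in\mathbf B$ with $\inf_{z\in\mathbb D^*}|a(z)|\ge2^{-1/2}+\epsilon$.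 Nonlinear Fourier series: for finitely supported $G:\mathbb Z\to\mathbb C$, the first row $(a,b)$ of the ordered product $\prod_k(1+|G_k|^2)^{-1/2}\begin{pmatrix}1&G_kz^k\\-\overline{G_k}z^{-k}&1\end{pmatrix}$ ($k$ increasing left to right); for $F\in\ell^2(\mathbb Z)$, write $F=F_-+F_+$ with $F_-$ supported in $(-\infty,-1]$, $F_+$ in $[0,\infty)$, let $(a_\pm,b_\pm)$ be the $\rho$-limits of the nonlinear Fourier series of $F_+\mathbf 1_{[0,k]}$, resp. $F_-\mathbf 1_{[-k,-1]}$, and define the nonlinear Fourier series of $F$ as $(a_-,b_-)(a_+,b_+)$. Each $(a,b)\in\mathbf B$ is the nonlinear Fourier series of a unique $F\in\ell^2(\mathbb Z)$. *)

theory Defs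
  imports "HOL-Analysis.Analysis"
begin

text \<open>A function on the unit circle T is represented by a function complex => complex;
only its values on T (via t |-> cis t, t in [0, 2 pi]) matter.  T carries the normalized
arc-length (Haar probability) measure.\<close>

definition Tmeas :: "real measure" where
  "Tmeas = lebesgue_on {0..2*pi}"

definition T_int :: "(complex \<Rightarrow> complex) \<Rightarrow> complex" where
  "T_int f = complex_of_real (1 / (2*pi)) * (LINT t|Tmeas. f (cis t))"

definition T_L2 :: "(complex \<Rightarrow> complex) \<Rightarrow> bool" where
  "T_L2 f \<longleftrightarrow> (\<lambda>t. f (cis t)) \<in> borel_measurable Tmeas
       \<and> integrable Tmeas (\<lambda>t. (cmod (f (cis t)))^2)"

definition l2norm :: "(complex \<Rightarrow> complex) \<Rightarrow> real" where
  "l2norm f = sqrt ((1 / (2*pi)) * (LINT t|Tmeas. (cmod (f (cis t)))^2))"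

definition fcoef :: "(complex \<Rightarrow> complex) \<Rightarrow> int \<Rightarrow> complex" where
  "fcoef f k = T_int (\<lambda>z. f z * z powi (-k))"

definition star :: "(complex \<Rightarrow> complex) \<Rightarrow> complex \<Rightarrow> complex" where
  "star f z = cnj (f (inverse (cnj z)))"

definition H2_D :: "(complex \<Rightarrow> complex) \<Rightarrow> bool" where
  "H2_D f \<longleftrightarrow> T_L2 f \<and> (\<forall>k<0. fcoef f k = 0)"

definition H2_Dstar :: "(complex \<Rightarrow> complex) \<Rightarrow> bool" where
  "H2_Dstar f \<longleftrightarrow> H2_D (star f)"

definition ext_D :: "(complex \<Rightarrow> complex) \<Rightarrow> complex \<Rightarrow> complex" where
  "ext_D g z = (\<Sum>n. fcoef g (int n) * z ^ n)"

text \<open>Analytic extension of an H^2(D^*) function to the finite part {|w| > 1} of D^*,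
  via f(w) = conj (f^*(conj w ^-1)), and its value at infinity f(\<infinity>) = conj (f^*(0)).\<close>
definition ext_Dstar :: "(complex \<Rightarrow> complex) \<Rightarrow> complex \<Rightarrow> complex" where
  "ext_Dstar f w = cnj (ext_D (star f) (inverse (cnj w)))"

definition at_inf :: "(complex \<Rightarrow> complex) \<Rightarrow> complex" where
  "at_inf f = cnj (fcoef (star f) 0)"

text \<open>The finite points of D^* are exactly the w with |w| > 1; the remaining point is \<infinity>.\<close>
definition inf_abs_sq_Dstar :: "(complex \<Rightarrow> complex) \<Rightarrow> real" where
  "inf_abs_sq_Dstar a =
     Inf ({(cmod (ext_Dstar a w))^2 | w. cmod w > 1} \<union> {(cmod (at_inf a))^2})"

definition inf_abs_Dstar :: "(complex \<Rightarrow> complex) \<Rightarrow> real" where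
  "inf_abs_Dstar a =
     Inf ({cmod (ext_Dstar a w) | w. cmod w > 1} \<union> {cmod (at_inf a)})"

type_synonym cpair = "(complex \<Rightarrow> complex) \<times> (complex \<Rightarrow> complex)"

definition Lspace :: "cpair set" where
  "Lspace = {(a, b). (\<lambda>t. a (cis t)) \<in> borel_measurable Tmeas
                   \<and> (\<lambda>t. b (cis t)) \<in> borel_measurable Tmeas
                   \<and> (AE t in Tmeas. a (cis t) * star a (cis t) + b (cis t) * star b (cis t) = 1)
                   \<and> H2_Dstar a
                   \<and> Im (at_inf a) = 0 \<and> Re (at_inf a) > 0}"

definition rho :: "cpair \<Rightarrow> cpair \<Rightarrow> real" where
  "rho P Q = l2norm (\<lambda>z. fst P z - fst Q z) + l2norm (\<lambda>z. snd P z - snd Q z)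
             + \<bar>ln (Re (at_inf (fst P))) - ln (Re (at_inf (fst Q)))\<bar>"

definition Bspace :: "cpair set" where
  "Bspace = {(a, b). (a, b) \<in> Lspace \<and> inf_abs_sq_Dstar a > 1/2}"

definition Beps :: "real \<Rightarrow> cpair set" where
  "Beps \<epsilon> = {(a, b). (a, b) \<in> Bspace \<and> inf_abs_Dstar a \<ge> 1 / sqrt 2 + \<epsilon>}"

definition pmul :: "cpair \<Rightarrow> cpair \<Rightarrow> cpair" where
  "pmul P Q = (\<lambda>z. fst P z * fst Q z - snd P z * star (snd Q) z,
               \<lambda>z. fst P z * snd Q z + snd P z * star (fst Q) z)"

definition pone :: cpair where
  "pone = (\<lambda>z. 1, \<lambda>z. 0)"

text \<open>First row of (1+|G_k|^2)^(-1/2) [[1, G_k z^k], [-conj G_k z^-k, 1]].\<close>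
definition nlf_factor :: "(int \<Rightarrow> complex) \<Rightarrow> int \<Rightarrow> cpair" where
  "nlf_factor G k = (\<lambda>z. complex_of_real (1 / sqrt (1 + (cmod (G k))^2)),
                     \<lambda>z. complex_of_real (1 / sqrt (1 + (cmod (G k))^2)) * G k * z powi k)"

definition nlfs_fin :: "(int \<Rightarrow> complex) \<Rightarrow> cpair" where
  "nlfs_fin G = foldr (\<lambda>k acc. pmul (nlf_factor G k) acc)
                   (sorted_list_of_set {k. G k \<noteq> 0}) pone"

definition l2seq :: "(int \<Rightarrow> complex) \<Rightarrow> bool" where
  "l2seq F \<longleftrightarrow> (\<lambda>k. (cmod (F k))^2) summable_on UNIV"

definition rho_limit :: "(nat \<Rightarrow> cpair) \<Rightarrow> cpair \<Rightarrow> bool" where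
  "rho_limit S P \<longleftrightarrow> P \<in> Lspace \<and> (\<lambda>k. rho (S k) P) \<longlonglongrightarrow> 0"

text \<open>(a,b) is the nonlinear Fourier series of F (equality of pairs of L^2 functions,
  i.e. almost everywhere on T).\<close>
definition is_nlfs :: "(int \<Rightarrow> complex) \<Rightarrow> cpair \<Rightarrow> bool" where
  "is_nlfs F P \<longleftrightarrow>
     (\<exists>Pp Pm.
        rho_limit (\<lambda>k. nlfs_fin (\<lambda>j. if 0 \<le> j \<and> j \<le> int k then F j else 0)) Pp
      \<and> rho_limit (\<lambda>k. nlfs_fin (\<lambda>j. if - int k \<le> j \<and> j \<le> -1 then F j else 0)) Pm
      \<and> (AE t in Tmeas. fst P (cis t) = fst (pmul Pm Pp) (cis t)
                      \<and> snd P (cis t) = snd (pmul Pm Pp) (cis t)))"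

definition Hnorm :: "cpair \<Rightarrow> real" where
  "Hnorm P = sqrt ((l2norm (fst P))^2 + (l2norm (snd P))^2)"

end

theory Submission
  imports Defs "HOL-Complex_Analysis.Complex_Analysis"
begin

text \<open>
  Let \<open>(a, b) = (am, bm) (ap, bp)\<close> be the factorization into the parts of the sequence on the negative
  and on the nonnegative integers, and put \<open>r = b / a\<close>, \<open>A = ap / ap(\<infinity>)\<close>, \<open>B = bp / ap(\<infinity>)\<close>.
  Since \<open>1 / a\<close> is bounded analytic in the exterior disc, \<open>B - r A = - bm / (a ap(\<infinity>))\<close> has only
  negative frequencies and \<open>A\<^sup>* + r B\<^sup>* = am / (a ap(\<infinity>))\<close> only nonpositive ones, while \<open>F 0\<close> is the
  zeroth Fourier coefficient of \<open>B\<close>. So \<open>(A, B)\<close> solves a linear system given by the identity plus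
  a skew-adjoint operator depending linearly on \<open>r\<close>. With \<open>r' = d / c\<close>, testing the difference of the
  systems for \<open>r\<close> and \<open>r'\<close> against the difference \<open>\<delta>\<close> of their solutions cancels the skew part and
  yields \<open>\<parallel>\<delta>\<parallel>\<^sup>2 \<le> 2 \<parallel>r - r'\<parallel>\<^sup>2\<close>; as \<open>\<bar>r - r'\<bar>\<^sup>2 \<le> 4 (\<bar>a - c\<bar>\<^sup>2 + \<bar>b - d\<bar>\<^sup>2)\<close>, this gives the
  Lipschitz constant \<open>2 \<surd>2\<close>. The claimed constant is larger because
  \<open>1 / \<surd>2 + \<epsilon> \<le> \<bar>a(\<infinity>)\<bar> \<le> 1\<close>.
\<close>

subsection \<open>Bounded functions on the circle\<close>

text \<open>Essentially bounded functions are the working class: the entries of pairs in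
  \<open>Lspace\<close> have modulus at most 1 almost everywhere, and unlike L^2 the class is closed
  under products, so integrability comes for free.\<close>

definition Linf :: "(complex \<Rightarrow> complex) \<Rightarrow> bool" where
  "Linf f \<longleftrightarrow> (\<lambda>t. f (cis t)) \<in> borel_measurable Tmeas \<and> (\<exists>C. AE t in Tmeas. cmod (f (cis t)) \<le> C)"

lemma finite_measure_Tmeas: "finite_measure Tmeas"
  unfolding Tmeas_def by (rule finite_measure_lebesgue_on) simp

lemma measure_Tmeas: "measure Tmeas (space Tmeas) = 2 * pi"
  by (simp add: Tmeas_def measure_restrict_space)

lemma cnj_measurable: "f \<in> borel_measurable M \<Longrightarrow> (\<lambda>x. cnj (f x)) \<in> borel_measurable M"
  by (rule measurable_compose[of f M borel]) (auto intro!: borel_measurable_continuous_onI continuous_intros)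

lemma Linf_I:
  assumes "(\<lambda>t. f (cis t)) \<in> borel_measurable Tmeas" "AE t in Tmeas. cmod (f (cis t)) \<le> C"
  shows "Linf f"
  using assms unfolding Linf_def by blast

lemma Linf_measurable [measurable_dest]: "Linf f \<Longrightarrow> (\<lambda>t. f (cis t)) \<in> borel_measurable Tmeas"
  by (simp add: Linf_def)

lemma Linf_bound:
  assumes "Linf f"
  obtains C where "C \<ge> 0" "AE t in Tmeas. cmod (f (cis t)) \<le> C"
proof -
  obtain C where "AE t in Tmeas. cmod (f (cis t)) \<le> C" using assms by (auto simp: Linf_def)
  then have "AE t in Tmeas. cmod (f (cis t)) \<le> max C 0" by eventually_elim auto
  then show ?thesis by (intro that[of "max C 0"]) auto
qed

lemma Linf_continuous:
  assumes "continuous_on (sphere 0 1) f"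
  shows "Linf f"
proof -
  have c: "continuous_on {0..2*pi} (\<lambda>t. f (cis t))"
    by (rule continuous_on_compose2[OF assms]) (auto intro: continuous_intros)
  have "bounded (f ` sphere 0 1)"
    by (intro compact_imp_bounded compact_continuous_image assms) simp
  then obtain C where "\<And>z. z \<in> sphere 0 1 \<Longrightarrow> cmod (f z) \<le> C"
    unfolding bounded_iff by blast
  then have "AE t in Tmeas. cmod (f (cis t)) \<le> C" by simp
  moreover have "(\<lambda>t. f (cis t)) \<in> borel_measurable Tmeas"
    unfolding Tmeas_def by (rule continuous_imp_measurable_on_sets_lebesgue[OF c]) simp
  ultimately show ?thesis by (rule Linf_I[rotated])
qed

lemma Linf_const [simp, intro]: "Linf (\<lambda>_. c)"
  by (rule Linf_continuous) simp

lemma Linf_powi [simp, intro]: "Linf (\<lambda>z. z powi k)"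
  by (rule Linf_continuous) (auto intro!: continuous_intros)

lemma Linf_add [intro]:
  assumes "Linf f" "Linf g" shows "Linf (\<lambda>z. f z + g z)"
proof -
  obtain C D where "AE t in Tmeas. cmod (f (cis t)) \<le> C" "AE t in Tmeas. cmod (g (cis t)) \<le> D"
    using assms by (auto simp: Linf_def)
  then have "AE t in Tmeas. cmod (f (cis t) + g (cis t)) \<le> C + D"
    by eventually_elim (use norm_triangle_mono in blast)
  with assms show ?thesis by (intro Linf_I) (auto simp: Linf_def)
qed

lemma Linf_mult [intro]:
  assumes "Linf f" "Linf g" shows "Linf (\<lambda>z. f z * g z)"
proof -
  obtain C where "C \<ge> 0" "AE t in Tmeas. cmod (f (cis t)) \<le> C"
    using assms(1) by (rule Linf_bound)
  moreover obtain D where "AE t in Tmeas. cmod (g (cis t)) \<le> D"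
    using assms(2) by (rule Linf_bound)
  ultimately have "AE t in Tmeas. cmod (f (cis t)) \<le> C" "AE t in Tmeas. cmod (g (cis t)) \<le> D" by auto
  then have "AE t in Tmeas. cmod (f (cis t) * g (cis t)) \<le> C * D"
    by eventually_elim (use \<open>C \<ge> 0\<close> in \<open>auto simp: norm_mult intro: mult_mono\<close>)
  with assms show ?thesis by (intro Linf_I) (auto simp: Linf_def)
qed

lemma Linf_uminus [intro]: "Linf f \<Longrightarrow> Linf (\<lambda>z. - f z)"
  using Linf_mult[of "\<lambda>_. -1" f] by simp

lemma Linf_diff [intro]: "Linf f \<Longrightarrow> Linf g \<Longrightarrow> Linf (\<lambda>z. f z - g z)"
  using Linf_add[of f "\<lambda>z. - g z"] Linf_uminus by simp

lemma Linf_sum [intro]: "(\<And>i. i \<in> I \<Longrightarrow> Linf (f i)) \<Longrightarrow> Linf (\<lambda>z. \<Sum>i\<in>I. f i z)"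
  by (induction I rule: infinite_finite_induct) (auto intro: Linf_add)

lemma Linf_cnj [intro]: "Linf f \<Longrightarrow> Linf (\<lambda>z. cnj (f z))"
  unfolding Linf_def by (auto intro: cnj_measurable)

lemma star_cis [simp]: "star f (cis t) = cnj (f (cis t))"
  by (simp add: star_def cis_cnj)

lemma Linf_star [intro]: "Linf f \<Longrightarrow> Linf (star f)"
  using Linf_cnj[of f] unfolding Linf_def by simp

lemma Linf_integrable: "Linf f \<Longrightarrow> integrable Tmeas (\<lambda>t. f (cis t))"
  unfolding Linf_def using finite_measure.integrable_const_bound[OF finite_measure_Tmeas] by auto

lemma Linf_integrable_norm_sq:
  assumes "Linf f" shows "integrable Tmeas (\<lambda>t. (cmod (f (cis t)))\<^sup>2)"
proof -
  have "integrable Tmeas (\<lambda>t. f (cis t) * cnj (f (cis t)))"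
    using Linf_integrable[OF Linf_mult[OF assms Linf_cnj[OF assms]]] .
  from integrable_norm[OF this] show ?thesis by (simp add: norm_mult power2_eq_square)
qed

section \<open>Normalized integral and L^2 norm\<close>

lemma T_int_add: "Linf f \<Longrightarrow> Linf g \<Longrightarrow> T_int (\<lambda>z. f z + g z) = T_int f + T_int g"
  unfolding T_int_def by (simp add: Linf_integrable ring_distribs)

lemma T_int_diff: "Linf f \<Longrightarrow> Linf g \<Longrightarrow> T_int (\<lambda>z. f z - g z) = T_int f - T_int g"
  unfolding T_int_def by (simp add: Linf_integrable right_diff_distrib)

lemma T_int_cmult [simp]: "T_int (\<lambda>z. c * f z) = c * T_int f"
  unfolding T_int_def by simp

lemma T_int_cmult2 [simp]: "T_int (\<lambda>z. f z * c) = T_int f * c"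
  unfolding T_int_def by simp

lemma T_int_sum: "(\<And>i. i \<in> I \<Longrightarrow> Linf (f i)) \<Longrightarrow> T_int (\<lambda>z. \<Sum>i\<in>I. f i z) = (\<Sum>i\<in>I. T_int (f i))"
proof (induction I rule: infinite_finite_induct)
  case (insert x F)
  then show ?case by (simp add: T_int_add Linf_sum)
qed (auto simp: T_int_def)

lemma T_int_cnj: "T_int (\<lambda>z. cnj (f z)) = cnj (T_int f)"
  unfolding T_int_def by simp

lemma T_int_cong_AE:
  assumes "AE t in Tmeas. f (cis t) = g (cis t)"
    "(\<lambda>t. f (cis t)) \<in> borel_measurable Tmeas" "(\<lambda>t. g (cis t)) \<in> borel_measurable Tmeas"
  shows "T_int f = T_int g"
  unfolding T_int_def using integral_cong_AE[OF assms(2,3,1)] by simp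

lemma T_int_cong: "(\<And>t. f (cis t) = g (cis t)) \<Longrightarrow> T_int f = T_int g"
  unfolding T_int_def by simp

lemma T_int_const [simp]: "T_int (\<lambda>_. c) = c"
  unfolding T_int_def by (simp add: measure_Tmeas scaleR_conv_of_real)

lemma l2norm_sq: "(l2norm f)\<^sup>2 = (1 / (2*pi)) * (LINT t|Tmeas. (cmod (f (cis t)))\<^sup>2)"
  unfolding l2norm_def by (subst real_sqrt_pow2) (auto intro!: divide_nonneg_nonneg Bochner_Integration.integral_nonneg)

lemma l2norm_nonneg [simp]: "l2norm f \<ge> 0"
  unfolding l2norm_def by (auto intro!: divide_nonneg_nonneg Bochner_Integration.integral_nonneg)

lemma T_int_self: "T_int (\<lambda>z. f z * cnj (f z)) = of_real ((l2norm f)\<^sup>2)"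
proof -
  have "T_int (\<lambda>z. f z * cnj (f z)) = T_int (\<lambda>z. of_real ((cmod (f z))\<^sup>2))"
    by (rule T_int_cong) (simp add: complex_norm_square[symmetric])
  also have "\<dots> = of_real ((l2norm f)\<^sup>2)"
    unfolding T_int_def l2norm_sq by (subst integral_complex_of_real) (simp only: of_real_mult)
  finally show ?thesis .
qed

lemma l2norm_sq_mono_AE:
  assumes "Linf f" "Linf g" "AE t in Tmeas. cmod (f (cis t)) \<le> C * cmod (g (cis t))"
  shows "(l2norm f)\<^sup>2 \<le> C\<^sup>2 * (l2norm g)\<^sup>2"
proof -
  have "(LINT t|Tmeas. (cmod (f (cis t)))\<^sup>2) \<le> (LINT t|Tmeas. C\<^sup>2 * (cmod (g (cis t)))\<^sup>2)"
  proof (rule integral_mono_AE)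
    show "AE t in Tmeas. (cmod (f (cis t)))\<^sup>2 \<le> C\<^sup>2 * (cmod (g (cis t)))\<^sup>2"
      using assms(3) by eventually_elim (metis norm_ge_zero power_mono power_mult_distrib)
  qed (auto intro: Linf_integrable_norm_sq assms)
  then have "(1 / (2*pi)) * (LINT t|Tmeas. (cmod (f (cis t)))\<^sup>2) \<le> (1 / (2*pi)) * (LINT t|Tmeas. C\<^sup>2 * (cmod (g (cis t)))\<^sup>2)"
    by (rule mult_left_mono) simp
  then show ?thesis unfolding l2norm_sq by (simp add: mult_ac)
qed

lemma l2norm_mono_AE:
  assumes "Linf f" "Linf g" "AE t in Tmeas. cmod (f (cis t)) \<le> C * cmod (g (cis t))" "C \<ge> 0"
  shows "l2norm f \<le> C * l2norm g"
proof (rule power2_le_imp_le)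
  show "(l2norm f)\<^sup>2 \<le> (C * l2norm g)\<^sup>2"
    using l2norm_sq_mono_AE[OF assms(1-3)] by (simp add: power_mult_distrib)
qed (use assms(4) in simp)

text \<open>Jensen's inequality, as nonnegativity of the variance.\<close>
lemma T_int_le_l2norm:
  assumes "Linf f" shows "cmod (T_int f) \<le> l2norm f"
proof -
  define m where "m = T_int f"
  have [intro]: "Linf f" by fact
  have "of_real ((l2norm (\<lambda>z. f z - m))\<^sup>2) = T_int (\<lambda>z. (f z - m) * cnj (f z - m))"
    by (simp only: T_int_self)
  also have "\<dots> = T_int (\<lambda>z. (f z * cnj (f z) - m * cnj (f z)) - (f z * cnj m - m * cnj m))"
    by (simp add: algebra_simps)
  also have "\<dots> = T_int (\<lambda>z. f z * cnj (f z) - m * cnj (f z)) - T_int (\<lambda>z. f z * cnj m - m * cnj m)"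
    by (rule T_int_diff) (intro Linf_diff Linf_mult Linf_cnj Linf_const assms)+
  also have "T_int (\<lambda>z. f z * cnj (f z) - m * cnj (f z)) = T_int (\<lambda>z. f z * cnj (f z)) - T_int (\<lambda>z. m * cnj (f z))"
    by (rule T_int_diff) (intro Linf_diff Linf_mult Linf_cnj Linf_const assms)+
  also have "T_int (\<lambda>z. f z * cnj m - m * cnj m) = T_int (\<lambda>z. f z * cnj m) - T_int (\<lambda>z. m * cnj m)"
    by (rule T_int_diff) (intro Linf_diff Linf_mult Linf_cnj Linf_const assms)+
  also have "T_int (\<lambda>z. f z * cnj (f z)) = of_real ((l2norm f)\<^sup>2)" by (rule T_int_self)
  also have "T_int (\<lambda>z. m * cnj (f z)) = m * cnj m" by (simp only: T_int_cmult T_int_cnj m_def)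
  also have "T_int (\<lambda>z. f z * cnj m) = m * cnj m" by (simp only: T_int_cmult2 m_def)
  also have "T_int (\<lambda>z. m * cnj m) = m * cnj m" by (rule T_int_const)
  finally have "of_real ((l2norm (\<lambda>z. f z - m))\<^sup>2) = (of_real ((l2norm f)\<^sup>2) - m * cnj m :: complex)"
    by simp
  also have "\<dots> = of_real ((l2norm f)\<^sup>2 - (cmod m)\<^sup>2)"
    unfolding complex_norm_square[symmetric] by simp
  finally have "(l2norm (\<lambda>z. f z - m))\<^sup>2 = (l2norm f)\<^sup>2 - (cmod m)\<^sup>2"
    using of_real_eq_iff by blast
  then have "(cmod m)\<^sup>2 \<le> (l2norm f)\<^sup>2" using zero_le_power2[of "l2norm (\<lambda>z. f z - m)"] by linarith
  then show ?thesis unfolding m_def by (rule power2_le_imp_le) simp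
qed

subsection \<open>Fourier coefficients\<close>

lemma Linf_mult_powi [intro]: "Linf f \<Longrightarrow> Linf (\<lambda>z. f z * z powi k)"
  by (intro Linf_mult Linf_powi)

lemma T_int_powi: "T_int (\<lambda>z. z powi k) = (if k = 0 then 1 else 0)"
proof (cases "k = 0")
  case False
  \<comment> \<open>An antiderivative of the integrand, with equal values at both endpoints because
    \<open>k\<close> is an integer.\<close>
  define F where "F = (\<lambda>t. cis (of_int k * t) / (\<i> * of_int k))"
  have "((\<lambda>t. cis (of_int k * t)) has_integral (F (2*pi) - F 0)) {0..2*pi}"
  proof (rule fundamental_theorem_of_calculus)
    fix t
    have "((\<lambda>w. exp (\<i> * (of_int k * w)) / (\<i> * of_int k)) has_field_derivative
             exp (\<i> * (of_int k * of_real t))) (at (of_real t))"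
      using False by (auto intro!: derivative_eq_intros simp: field_simps)
    from has_vector_derivative_real_field[OF this, of "{0..2*pi}"]
    show "(F has_vector_derivative cis (of_int k * t)) (at t within {0..2*pi})"
      by (simp add: F_def cis_conv_exp)
  qed simp
  moreover have "F (2*pi) = F 0"
    using cis_multiple_2pi[of "of_int k"] by (simp add: F_def mult_ac)
  ultimately have "integral {0..2*pi} (\<lambda>t. cis (of_int k * t)) = 0"
    by (simp add: integral_unique)
  moreover have "integrable (lebesgue_on {0..2*pi}) (\<lambda>t. cis (of_int k * t))"
    using Linf_integrable[OF Linf_powi[of k]] by (simp add: cis_power_int Tmeas_def)
  ultimately have "(LINT t|Tmeas. cis (of_int k * t)) = 0"
    unfolding Tmeas_def by (subst lebesgue_integral_eq_integral) auto
  then show ?thesis using False by (simp add: T_int_def cis_power_int)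
qed simp

lemma powi_mult_cis: "cis t powi j * cis t powi k = cis t powi (j + k)"
  by (simp add: power_int_add)

lemma fcoef_add: "Linf f \<Longrightarrow> Linf g \<Longrightarrow> fcoef (\<lambda>z. f z + g z) k = fcoef f k + fcoef g k"
  unfolding fcoef_def by (simp add: ring_distribs T_int_add Linf_mult_powi)

lemma fcoef_diff: "Linf f \<Longrightarrow> Linf g \<Longrightarrow> fcoef (\<lambda>z. f z - g z) k = fcoef f k - fcoef g k"
  unfolding fcoef_def by (simp add: left_diff_distrib T_int_diff Linf_mult_powi)

lemma fcoef_cmult: "fcoef (\<lambda>z. c * f z) k = c * fcoef f k"
  unfolding fcoef_def by (simp add: mult.assoc)

lemma fcoef_sum: "(\<And>i. i \<in> I \<Longrightarrow> Linf (f i)) \<Longrightarrow> fcoef (\<lambda>z. \<Sum>i\<in>I. f i z) k = (\<Sum>i\<in>I. fcoef (f i) k)"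
  unfolding fcoef_def by (simp add: sum_distrib_right T_int_sum Linf_mult_powi)

lemma fcoef_shift: "fcoef (\<lambda>z. f z * z powi j) k = fcoef f (k - j)"
  unfolding fcoef_def by (rule T_int_cong) (simp add: mult.assoc powi_mult_cis)

lemma fcoef_powi: "fcoef (\<lambda>z. z powi j) k = (if k = j then 1 else 0)"
proof -
  have "fcoef (\<lambda>z. z powi j) k = T_int (\<lambda>z. z powi (j - k))"
    unfolding fcoef_def by (rule T_int_cong) (simp add: powi_mult_cis)
  then show ?thesis by (simp add: T_int_powi)
qed

lemma fcoef_cnj: "fcoef (\<lambda>z. cnj (f z)) k = cnj (fcoef f (-k))"
  unfolding fcoef_def T_int_cnj[symmetric]
  by (rule T_int_cong) (simp add: cis_power_int cis_cnj)

lemma fcoef_star: "fcoef (star f) k = cnj (fcoef f (-k))"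
  unfolding fcoef_cnj[symmetric] unfolding fcoef_def by (rule T_int_cong) simp

lemma fcoef_cong_AE:
  assumes "AE t in Tmeas. f (cis t) = g (cis t)" "Linf f" "Linf g"
  shows "fcoef f k = fcoef g k"
  unfolding fcoef_def
proof (rule T_int_cong_AE)
  show "AE t in Tmeas. f (cis t) * cis t powi - k = g (cis t) * cis t powi - k"
    using assms(1) by eventually_elim simp
qed (use Linf_mult_powi[OF assms(2)] Linf_mult_powi[OF assms(3)] in \<open>auto simp: Linf_def\<close>)

lemma fcoef_cong: "(\<And>t. f (cis t) = g (cis t)) \<Longrightarrow> fcoef f k = fcoef g k"
  unfolding fcoef_def by (rule T_int_cong) simp

lemma l2norm_cong: "(\<And>t. cmod (f (cis t)) = cmod (g (cis t))) \<Longrightarrow> l2norm f = l2norm g"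
  unfolding l2norm_def by simp

lemma fcoef_le_l2norm: "Linf f \<Longrightarrow> cmod (fcoef f k) \<le> l2norm f"
proof -
  assume "Linf f"
  then have "cmod (fcoef f k) \<le> l2norm (\<lambda>z. f z * z powi (-k))"
    unfolding fcoef_def by (intro T_int_le_l2norm Linf_mult_powi)
  also have "\<dots> = l2norm f" by (rule l2norm_cong) (simp add: norm_mult norm_power_int)
  finally show ?thesis .
qed

text \<open>Pointwise \<open>(x + y)\<^sup>2 \<le> 2 * x\<^sup>2 + 2 * y\<^sup>2\<close>. This
  stands in for Minkowski's inequality in the density argument, where constants are
  immaterial.\<close>

lemma l2norm_sq_add_le:
  assumes "Linf f" "Linf g"
  shows "(l2norm (\<lambda>z. f z + g z))\<^sup>2 \<le> 2 * (l2norm f)\<^sup>2 + 2 * (l2norm g)\<^sup>2"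
proof -
  have "(LINT t|Tmeas. (cmod (f (cis t) + g (cis t)))\<^sup>2)
     \<le> (LINT t|Tmeas. 2 * (cmod (f (cis t)))\<^sup>2 + 2 * (cmod (g (cis t)))\<^sup>2)"
  proof (rule integral_mono)
    fix t
    have "cmod (f (cis t) + g (cis t)) \<le> cmod (f (cis t)) + cmod (g (cis t))"
      by (rule norm_triangle_ineq)
    then have "(cmod (f (cis t) + g (cis t)))\<^sup>2 \<le> (cmod (f (cis t)) + cmod (g (cis t)))\<^sup>2"
      by (rule power_mono) simp
    also have "\<dots> \<le> 2 * (cmod (f (cis t)))\<^sup>2 + 2 * (cmod (g (cis t)))\<^sup>2"
      using zero_le_power2[of "cmod (f (cis t)) - cmod (g (cis t))"]
      by (simp add: power2_eq_square algebra_simps)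
    finally show "(cmod (f (cis t) + g (cis t)))\<^sup>2 \<le> 2 * (cmod (f (cis t)))\<^sup>2 + 2 * (cmod (g (cis t)))\<^sup>2" .
  qed (use Linf_integrable_norm_sq[OF Linf_add[OF assms]] assms in \<open>auto intro!: Linf_integrable_norm_sq\<close>)
  also have "\<dots> = 2 * (LINT t|Tmeas. (cmod (f (cis t)))\<^sup>2) + 2 * (LINT t|Tmeas. (cmod (g (cis t)))\<^sup>2)"
    by (simp add: Linf_integrable_norm_sq assms)
  finally have "(1 / (2*pi)) * (LINT t|Tmeas. (cmod (f (cis t) + g (cis t)))\<^sup>2)
     \<le> (1 / (2*pi)) * (2 * (LINT t|Tmeas. (cmod (f (cis t)))\<^sup>2) + 2 * (LINT t|Tmeas. (cmod (g (cis t)))\<^sup>2))"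
    by (rule mult_left_mono) simp
  then show ?thesis unfolding l2norm_sq by (simp add: algebra_simps)
qed

section \<open>Orthogonality and the exact approximation error\<close>

lemma T_int_mult_cnj_trig:
  assumes "Linf f" "finite K"
  shows "T_int (\<lambda>z. f z * cnj (\<Sum>k\<in>K. p k * z powi k)) = (\<Sum>k\<in>K. fcoef f k * cnj (p k))"
proof -
  have "T_int (\<lambda>z. f z * cnj (\<Sum>k\<in>K. p k * z powi k)) = T_int (\<lambda>z. \<Sum>k\<in>K. f z * z powi (-k) * cnj (p k))"
    by (rule T_int_cong) (auto simp: cis_power_int cis_cnj sum_distrib_left intro!: sum.cong)
  also have "\<dots> = (\<Sum>k\<in>K. T_int (\<lambda>z. f z * z powi (-k) * cnj (p k)))"
    by (rule T_int_sum) (intro Linf_mult assms Linf_powi Linf_const)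
  finally show ?thesis by (simp add: fcoef_def)
qed

lemma Linf_trig [intro]: "Linf (\<lambda>z. \<Sum>k\<in>K. p k * z powi k)"
  by (intro Linf_sum Linf_mult Linf_const Linf_powi)

lemma fcoef_trig: "finite K \<Longrightarrow> fcoef (\<lambda>z. \<Sum>k\<in>K. p k * z powi k) j = (if j \<in> K then p j else 0)"
  by (subst fcoef_sum) (auto simp: fcoef_cmult fcoef_powi if_distrib sum.delta cong: if_cong intro!: Linf_mult)

text \<open>Orthonormality of the powers turns the expanded square into a sum of squares that is
  smallest at \<open>p = fcoef f\<close>. Bessel's inequality and Parseval's identity are both read
  off from it.\<close>

lemma l2norm_sq_diff_trig:
  assumes "Linf f" "finite K"
  shows "(l2norm (\<lambda>z. f z - (\<Sum>k\<in>K. p k * z powi k)))\<^sup>2 =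
         (l2norm f)\<^sup>2 - (\<Sum>k\<in>K. (cmod (fcoef f k))\<^sup>2) + (\<Sum>k\<in>K. (cmod (fcoef f k - p k))\<^sup>2)"
proof -
  define P where "P = (\<lambda>z. \<Sum>k\<in>K. p k * z powi k)"
  have [intro]: "Linf f" "Linf P" using assms by (auto simp: P_def)
  have 1: "T_int (\<lambda>z. f z * cnj (P z)) = (\<Sum>k\<in>K. fcoef f k * cnj (p k))"
    unfolding P_def by (rule T_int_mult_cnj_trig[OF assms])
  have "T_int (\<lambda>z. P z * cnj (f z)) = cnj (T_int (\<lambda>z. f z * cnj (P z)))"
    unfolding T_int_cnj[symmetric] by (simp add: mult.commute)
  also have "\<dots> = (\<Sum>k\<in>K. cnj (fcoef f k) * p k)" unfolding 1 by simp
  finally have 2: "T_int (\<lambda>z. P z * cnj (f z)) = (\<Sum>k\<in>K. cnj (fcoef f k) * p k)" .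
  have "T_int (\<lambda>z. P z * cnj (P z)) = (\<Sum>k\<in>K. fcoef P k * cnj (p k))"
    unfolding P_def by (rule T_int_mult_cnj_trig) (use assms in auto)
  also have "\<dots> = (\<Sum>k\<in>K. p k * cnj (p k))"
    by (rule sum.cong) (auto simp: P_def fcoef_trig assms)
  finally have 3: "T_int (\<lambda>z. P z * cnj (P z)) = (\<Sum>k\<in>K. p k * cnj (p k))" .
  have "complex_of_real ((l2norm (\<lambda>z. f z - P z))\<^sup>2) = T_int (\<lambda>z. (f z - P z) * cnj (f z - P z))"
    by (simp only: T_int_self)
  also have "\<dots> = T_int (\<lambda>z. (f z * cnj (f z) - f z * cnj (P z)) - (P z * cnj (f z) - P z * cnj (P z)))"
    by (simp add: algebra_simps)
  also have "\<dots> = T_int (\<lambda>z. f z * cnj (f z) - f z * cnj (P z)) - T_int (\<lambda>z. P z * cnj (f z) - P z * cnj (P z))"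
    by (rule T_int_diff; intro Linf_diff Linf_mult Linf_cnj \<open>Linf f\<close> \<open>Linf P\<close>)
  also have "T_int (\<lambda>z. f z * cnj (f z) - f z * cnj (P z)) = T_int (\<lambda>z. f z * cnj (f z)) - T_int (\<lambda>z. f z * cnj (P z))"
    by (rule T_int_diff; intro Linf_diff Linf_mult Linf_cnj \<open>Linf f\<close> \<open>Linf P\<close>)
  also have "T_int (\<lambda>z. P z * cnj (f z) - P z * cnj (P z)) = T_int (\<lambda>z. P z * cnj (f z)) - T_int (\<lambda>z. P z * cnj (P z))"
    by (rule T_int_diff; intro Linf_diff Linf_mult Linf_cnj \<open>Linf f\<close> \<open>Linf P\<close>)
  also have "T_int (\<lambda>z. f z * cnj (f z)) = of_real ((l2norm f)\<^sup>2)" by (rule T_int_self)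
  finally have "complex_of_real ((l2norm (\<lambda>z. f z - P z))\<^sup>2) = of_real ((l2norm f)\<^sup>2)
     - (\<Sum>k\<in>K. fcoef f k * cnj (fcoef f k)) + (\<Sum>k\<in>K. (fcoef f k - p k) * cnj (fcoef f k - p k))"
    unfolding 1 2 3 by (simp add: algebra_simps sum.distrib sum_subtractf)
  also have "\<dots> = of_real ((l2norm f)\<^sup>2 - (\<Sum>k\<in>K. (cmod (fcoef f k))\<^sup>2) + (\<Sum>k\<in>K. (cmod (fcoef f k - p k))\<^sup>2))"
    unfolding complex_norm_square[symmetric] by simp
  finally show ?thesis unfolding P_def of_real_eq_iff .
qed

subsection \<open>Density of trigonometric polynomials\<close>

text \<open>Laurent polynomials, with all negative powers collected in one denominator, so that
  closure under sums and products reduces to arithmetic of \<open>poly\<close>.\<close>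

definition trigpoly :: "(complex \<Rightarrow> complex) \<Rightarrow> bool" where
  "trigpoly f \<longleftrightarrow> (\<exists>N q. \<forall>z\<in>sphere 0 1. f z = inverse z ^ N * poly q z)"

lemma trigpoly_const: "trigpoly (\<lambda>_. c)"
  unfolding trigpoly_def by (rule exI[of _ 0], rule exI[of _ "[:c:]"]) simp

lemma trigpoly_mult:
  assumes "trigpoly f" "trigpoly g" shows "trigpoly (\<lambda>z. f z * g z)"
proof -
  obtain N q M r where "\<forall>z\<in>sphere 0 1. f z = inverse z ^ N * poly q z" "\<forall>z\<in>sphere 0 1. g z = inverse z ^ M * poly r z"
    using assms unfolding trigpoly_def by blast
  then have "\<forall>z\<in>sphere 0 1. f z * g z = inverse z ^ (N + M) * poly (q * r) z"
    by (simp add: power_add mult_ac)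
  then show ?thesis unfolding trigpoly_def by blast
qed

lemma trigpoly_add:
  assumes "trigpoly f" "trigpoly g" shows "trigpoly (\<lambda>z. f z + g z)"
proof -
  obtain N q M r where *: "\<forall>z\<in>sphere 0 1. f z = inverse z ^ N * poly q z" "\<forall>z\<in>sphere 0 1. g z = inverse z ^ M * poly r z"
    using assms unfolding trigpoly_def by blast
  \<comment> \<open>Common denominator: each numerator is multiplied by the other denominator's
    power of \<open>z\<close>.\<close>
  have "f z + g z = inverse z ^ (N + M) * poly (monom 1 M * q + monom 1 N * r) z" if z: "z \<in> sphere 0 1" for z
  proof -
    have "z \<noteq> 0" using z by auto
    then have "inverse z ^ M * z ^ M = 1" "inverse z ^ N * z ^ N = 1"
      by (simp_all flip: power_mult_distrib)
    moreover have "inverse z ^ (N + M) * poly (monom 1 M * q + monom 1 N * r) z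
       = inverse z ^ N * poly q z * (inverse z ^ M * z ^ M) + inverse z ^ M * poly r z * (inverse z ^ N * z ^ N)"
      by (simp add: poly_monom power_add algebra_simps)
    ultimately show ?thesis using * z by simp
  qed
  then show ?thesis unfolding trigpoly_def by blast
qed

lemma trigpoly_cong: "trigpoly f \<Longrightarrow> (\<And>z. z \<in> sphere 0 1 \<Longrightarrow> f z = g z) \<Longrightarrow> trigpoly g"
  unfolding trigpoly_def by (metis (full_types))

text \<open>Only the linear case has content: a real-linear functional is a combination of
  \<open>z\<close> and \<open>cnj z\<close>, and \<open>cnj z = inverse z\<close> on the
  circle.\<close>

lemma trigpoly_real_polynomial_function:
  assumes "real_polynomial_function f"
  shows "trigpoly (\<lambda>z. of_real (f z))"
  using assms
proof induction
  case (linear f)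
  interpret bounded_linear f by fact
  have "of_real (f z) = inverse z ^ 1 * poly [: (f 1 + \<i> * f \<i>) / 2, 0, (f 1 - \<i> * f \<i>) / 2 :] z"
    if "z \<in> sphere 0 1" for z
  proof -
    have "z * cnj z = 1" using that by (simp add: complex_norm_square[symmetric])
    then have z: "z \<noteq> 0" "cnj z = inverse z" using inverse_unique by fastforce+
    have "f z = f (Re z *\<^sub>R 1 + Im z *\<^sub>R \<i>)" by (simp add: scaleR_conv_of_real mult.commute complex_eq[symmetric])
    also have "\<dots> = Re z * f 1 + Im z * f \<i>" by (simp add: add scaleR)
    finally have "complex_of_real (f z) = (z + cnj z) / 2 * f 1 - \<i> * ((z - cnj z) / 2 * f \<i>)"
      unfolding complex_add_cnj complex_diff_cnj by (simp add: mult_ac)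
    also have "\<dots> = inverse z ^ 1 * poly [: (f 1 + \<i> * f \<i>) / 2, 0, (f 1 - \<i> * f \<i>) / 2 :] z"
      unfolding z(2) using z(1) by (simp add: field_simps)
    finally show ?thesis .
  qed
  then show ?case unfolding trigpoly_def by blast
qed (auto intro: trigpoly_const trigpoly_add trigpoly_mult)

lemma trigpoly_sum_form:
  assumes "trigpoly f"
  obtains K p where "finite K" "\<And>z. z \<in> sphere 0 1 \<Longrightarrow> f z = (\<Sum>k\<in>K. p k * z powi k)"
proof -
  obtain N q where *: "\<forall>z\<in>sphere 0 1. f z = inverse z ^ N * poly q z"
    using assms unfolding trigpoly_def by blast
  define K where "K = (\<lambda>i. int i - int N) ` {..degree q}"
  have "f z = (\<Sum>k\<in>K. coeff q (nat (k + int N)) * z powi k)" if z: "z \<in> sphere 0 1" for z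
  proof -
    have [simp]: "z \<noteq> 0" using z by auto
    have "(\<Sum>k\<in>K. coeff q (nat (k + int N)) * z powi k) = (\<Sum>i\<le>degree q. coeff q i * z powi (int i - int N))"
      unfolding K_def by (subst sum.reindex) (auto simp: inj_on_def)
    also have "\<dots> = (\<Sum>i\<le>degree q. inverse z ^ N * (coeff q i * z ^ i))"
      by (rule sum.cong) (auto simp: power_int_diff field_simps)
    also have "\<dots> = f z" using * z by (simp add: poly_altdef sum_distrib_left)
    finally show ?thesis by simp
  qed
  then show ?thesis by (intro that[of K "\<lambda>k. coeff q (nat (k + int N))"]) (auto simp: K_def)
qed

text \<open>Stone-Weierstrass in the plane yields a polynomial in the real coordinates, which
  restricts to a Laurent polynomial on the circle.\<close>

lemma trig_dense_continuous:
  assumes "continuous_on (sphere 0 1) f" "e > 0"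
  obtains K p where "finite K" "\<And>z. z \<in> sphere 0 1 \<Longrightarrow> cmod (f z - (\<Sum>k\<in>K. p k * z powi k)) < e"
proof -
  obtain g where g: "polynomial_function g" "\<And>z. z \<in> sphere 0 1 \<Longrightarrow> cmod (f z - g z) < e"
    using Stone_Weierstrass_polynomial_function[OF compact_sphere assms] by blast
  have "real_polynomial_function (Re \<circ> g)" "real_polynomial_function (Im \<circ> g)"
    using g(1) bounded_linear_Re bounded_linear_Im unfolding polynomial_function_def by blast+
  then have "trigpoly (\<lambda>z. of_real (Re (g z)) + \<i> * of_real (Im (g z)))"
    by (intro trigpoly_add trigpoly_mult trigpoly_const)
       (auto dest: trigpoly_real_polynomial_function simp: o_def)
  then have "trigpoly g" by (rule trigpoly_cong) (simp add: complex_eq[symmetric])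
  then obtain K p where "finite K" "\<And>z. z \<in> sphere 0 1 \<Longrightarrow> g z = (\<Sum>k\<in>K. p k * z powi k)"
    by (rule trigpoly_sum_form) blast
  with g(2) show ?thesis by (intro that[of K p]) auto
qed

text \<open>\<open>Arg2pi\<close> jumps at 1, so continuity does not follow by composition. Instead,
  the preimage of a closed set is the image under \<open>cis\<close> of a compact subset of the
  interval, hence closed; periodicity makes the two endpoints agree.\<close>

lemma continuous_on_circle_lift:
  fixes \<phi> :: "real \<Rightarrow> complex"
  assumes c: "continuous_on {0..2*pi} \<phi>" and per: "\<phi> (2*pi) = \<phi> 0"
  obtains \<psi> where "continuous_on (sphere 0 1) \<psi>" "\<And>t. t \<in> {0..2*pi} \<Longrightarrow> \<psi> (cis t) = \<phi> t"
proof -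
  define \<psi> where "\<psi> = (\<lambda>z. \<phi> (Arg2pi z))"
  have \<psi>: "\<psi> (cis t) = \<phi> t" if "t \<in> {0..2*pi}" for t
  proof (cases "t = 2*pi")
    case False
    then have "Arg2pi (cis t) = t"
      using that by (intro Arg2pi_unique[of 1]) (auto simp: cis_conv_exp)
    then show ?thesis by (simp add: \<psi>_def)
  qed (use Arg2pi_unique[of 1 0 1] in \<open>simp add: \<psi>_def per\<close>)
  have "continuous_on (sphere 0 1) \<psi>"
  proof (subst continuous_on_closed_vimage, safe)
    fix B :: "complex set" assume "closed B"
    have "\<psi> -` B \<inter> sphere 0 1 = cis ` (\<phi> -` B \<inter> {0..2*pi})"
    proof safe
      fix z assume z: "z \<in> sphere 0 1" "\<psi> z \<in> B"
      have "0 \<le> Arg2pi z" "Arg2pi z < 2*pi" "z = cis (Arg2pi z)"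
        using Arg2pi[of z] z by (auto simp: is_Arg_def cis_conv_exp)
      then show "z \<in> cis ` (\<phi> -` B \<inter> {0..2*pi})"
        using z by (auto simp: \<psi>_def intro!: image_eqI[of z cis "Arg2pi z"])
    qed (auto simp: \<psi>)
    moreover have "compact (\<phi> -` B \<inter> {0..2*pi})"
      using continuous_closedin_preimage[OF c \<open>closed B\<close>]
      by (metis Int_commute closedin_compact compact_Icc)
    ultimately show "closed (\<psi> -` B \<inter> sphere 0 1)"
      by (simp add: compact_imp_closed compact_continuous_image continuous_intros)
  qed simp
  with \<psi> show ?thesis by (rule that[rotated])
qed

text \<open>A bounded measurable function is an almost everywhere limit of continuous functions; clipping
  these to the bound and damping them to zero at the endpoints keeps them dominated and makes them
  periodic.\<close>
lemma continuous_dense_l2: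
  assumes f: "Linf f" and "e > 0"
  obtains g where "continuous_on (sphere 0 1) g" "(l2norm (\<lambda>z. f z - g z))\<^sup>2 < e"
proof -
  obtain C0 where "AE t in Tmeas. cmod (f (cis t)) \<le> C0" using f by (auto simp: Linf_def)
  then have C: "AE t in Tmeas. cmod (f (cis t)) \<le> max C0 1" by eventually_elim auto
  define C where "C = max C0 1"
  have "C > 0" by (simp add: C_def)
  have "(\<lambda>t. f (cis t)) measurable_on {0..2*pi}"
    using f by (subst measurable_on_iff_borel_measurable) (auto simp: Linf_def Tmeas_def)
  then obtain N g where N: "negligible N" and g: "\<And>n. continuous_on UNIV (g n)"
    and lim: "\<And>t. t \<notin> N \<Longrightarrow> (\<lambda>n. g n t) \<longlonglongrightarrow> (if t \<in> {0..2*pi} then f (cis t) else 0)"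
    unfolding measurable_on_def by blast
  define clip where "clip = (\<lambda>w::complex. (C / max C (cmod w)) *\<^sub>R w)"
  have clip_id: "clip w = w" if "cmod w \<le> C" for w
    using that \<open>C > 0\<close> by (simp add: clip_def max_def)
  have clip_le: "cmod (clip w) \<le> C" for w
    using \<open>C > 0\<close> by (auto simp: clip_def max_def field_simps)
  have clip_cont: "continuous_on UNIV clip"
    unfolding clip_def using \<open>C > 0\<close> by (intro continuous_intros) (auto simp: max_def)
  define \<theta> where "\<theta> = (\<lambda>n t. min 1 (of_nat n * (t * (2*pi - t)) :: real))"
  define \<phi> where "\<phi> = (\<lambda>n t. \<theta> n t *\<^sub>R clip (g n t))"
  have \<phi>_cont: "continuous_on S (\<phi> n)" for n S
    unfolding \<phi>_def \<theta>_def
    by (intro continuous_intros continuous_on_compose2[OF clip_cont] continuous_on_subset[OF g]) auto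
  have \<phi>_le: "cmod (\<phi> n t) \<le> C" if "t \<in> {0..2*pi}" for n t
  proof -
    have "\<bar>\<theta> n t\<bar> \<le> 1" using that by (auto simp: \<theta>_def min_def)
    with clip_le[of "g n t"] \<open>C > 0\<close> have "\<bar>\<theta> n t\<bar> * cmod (clip (g n t)) \<le> 1 * C" by (intro mult_mono) auto
    then show ?thesis by (simp add: \<phi>_def)
  qed
  \<comment> \<open>The endpoints join the exceptional set because \<open>\<theta> n\<close>
    vanishes there for every \<open>n\<close>.\<close>
  have "AE t in Tmeas. t \<notin> N \<union> {0, 2*pi}"
  proof -
    have "N \<union> {0, 2*pi} \<in> null_sets lebesgue"
      using N by (simp add: negligible_iff_null_sets null_sets.Un finite_imp_null_set_lborel null_sets_completionI)
    then have "AE t in lebesgue. t \<notin> N \<union> {0, 2*pi}" by (rule AE_not_in)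
    then show ?thesis unfolding Tmeas_def by (subst AE_restrict_space_iff) auto
  qed
  moreover have "AE t in Tmeas. t \<in> {0..2*pi}" by (rule AE_I2) (simp add: Tmeas_def)
  ultimately have ae: "AE t in Tmeas. (\<lambda>n. (cmod (f (cis t) - \<phi> n t))\<^sup>2) \<longlonglongrightarrow> 0"
    using C
  proof eventually_elim
    case (elim t)
    then have t: "t \<in> {0<..<2*pi}" by auto
    have "clip (f (cis t)) = f (cis t)" using elim by (simp add: clip_id C_def)
    moreover have "(\<lambda>n. clip (g n t)) \<longlonglongrightarrow> clip (f (cis t))"
      using lim[of t] elim clip_cont
      by (intro isCont_tendsto_compose[of _ clip]) (auto simp: continuous_on_eq_continuous_at)
    moreover have "(\<lambda>n. \<theta> n t) \<longlonglongrightarrow> 1"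
    proof -
      have "t * (2*pi - t) > 0" using t by auto
      then obtain n0 where n0: "1 < of_nat n0 * (t * (2*pi - t))" using reals_Archimedean3 by blast
      show ?thesis
      proof (rule tendsto_eventually, rule eventually_sequentiallyI)
        fix n assume "n0 \<le> n"
        then have "of_nat n0 * (t * (2*pi - t)) \<le> of_nat n * (t * (2*pi - t))"
          using \<open>t * (2*pi - t) > 0\<close> by (intro mult_right_mono) auto
        with n0 show "\<theta> n t = 1" by (simp add: \<theta>_def)
      qed
    qed
    ultimately have "(\<lambda>n. \<phi> n t) \<longlonglongrightarrow> 1 *\<^sub>R f (cis t)"
      unfolding \<phi>_def by (intro tendsto_scaleR) auto
    then have "(\<lambda>n. (cmod (f (cis t) - \<phi> n t))\<^sup>2) \<longlonglongrightarrow> (cmod (f (cis t) - 1 *\<^sub>R f (cis t)))\<^sup>2"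
      by (intro tendsto_intros)
    then show ?case by simp
  qed
  have \<phi>_meas: "\<phi> n \<in> borel_measurable Tmeas" for n
    unfolding Tmeas_def by (rule continuous_imp_measurable_on_sets_lebesgue[OF \<phi>_cont]) simp
  have "(\<lambda>n. LINT t|Tmeas. (cmod (f (cis t) - \<phi> n t))\<^sup>2) \<longlonglongrightarrow> (LINT t|Tmeas. 0)"
  proof (rule integral_dominated_convergence[where w = "\<lambda>_. (2 * C)\<^sup>2"])
    show "integrable Tmeas (\<lambda>_. (2 * C)\<^sup>2)"
      using finite_measure.integrable_const[OF finite_measure_Tmeas] .
    show "AE t in Tmeas. norm ((cmod (f (cis t) - \<phi> n t))\<^sup>2) \<le> (2 * C)\<^sup>2" for n
      using C \<open>AE t in Tmeas. t \<in> {0..2*pi}\<close>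
    proof eventually_elim
      case (elim t)
      have "cmod (f (cis t) - \<phi> n t) \<le> cmod (f (cis t)) + cmod (\<phi> n t)" by (rule norm_triangle_ineq4)
      also have "\<dots> \<le> 2 * C" using elim \<phi>_le[of t n] by (simp add: C_def)
      finally have "cmod (f (cis t) - \<phi> n t) \<le> 2 * C" .
      from power_mono[OF this, of 2] show ?case by simp
    qed
    show "(\<lambda>t. (cmod (f (cis t) - \<phi> n t))\<^sup>2) \<in> borel_measurable Tmeas" for n
      using \<phi>_meas[of n] Linf_measurable[OF f] by simp
  qed (use ae in simp_all)
  then have "(\<lambda>n. (1 / (2*pi)) * (LINT t|Tmeas. (cmod (f (cis t) - \<phi> n t))\<^sup>2)) \<longlonglongrightarrow> (1 / (2*pi)) * 0"
    by (intro tendsto_mult tendsto_const) simp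
  then obtain n where n: "(1 / (2*pi)) * (LINT t|Tmeas. (cmod (f (cis t) - \<phi> n t))\<^sup>2) < e"
    using order_tendstoD(2)[of _ _ sequentially e] \<open>e > 0\<close> by (fastforce simp: eventually_sequentially)
  obtain \<psi> where \<psi>: "continuous_on (sphere 0 1) \<psi>" "\<And>t. t \<in> {0..2*pi} \<Longrightarrow> \<psi> (cis t) = \<phi> n t"
    by (rule continuous_on_circle_lift[OF \<phi>_cont]) (auto simp: \<phi>_def \<theta>_def)
  have "(LINT t|Tmeas. (cmod (f (cis t) - \<phi> n t))\<^sup>2) = (LINT t|Tmeas. (cmod (f (cis t) - \<psi> (cis t)))\<^sup>2)"
    by (rule Bochner_Integration.integral_cong) (auto simp: Tmeas_def \<psi>)
  with n have "(l2norm (\<lambda>z. f z - \<psi> z))\<^sup>2 < e" by (simp add: l2norm_sq)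
  with \<psi>(1) show ?thesis by (rule that)
qed

lemma l2norm_sq_le_const:
  assumes "Linf f" "AE t in Tmeas. cmod (f (cis t)) \<le> C"
  shows "(l2norm f)\<^sup>2 \<le> C\<^sup>2"
proof -
  have 1: "of_real ((l2norm (\<lambda>_. 1))\<^sup>2) = (1::complex)"
    unfolding T_int_self[symmetric] by simp
  have "(l2norm f)\<^sup>2 \<le> C\<^sup>2 * (l2norm (\<lambda>_. 1))\<^sup>2"
    using assms by (intro l2norm_sq_mono_AE) auto
  also have "(l2norm (\<lambda>_. 1))\<^sup>2 = 1" using 1 of_real_eq_1_iff by blast
  finally show ?thesis by simp
qed

lemma trig_dense_l2:
  assumes f: "Linf f" and "e > 0"
  obtains K p where "finite K" "(l2norm (\<lambda>z. f z - (\<Sum>k\<in>K. p k * z powi k)))\<^sup>2 < e"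
proof -
  \<comment> \<open>Both errors are held to \<open>e / 4\<close>, since
    \<open>l2norm_sq_add_le\<close> doubles their sum; strictness comes from the first one.\<close>
  obtain g where g: "continuous_on (sphere 0 1) g" "(l2norm (\<lambda>z. f z - g z))\<^sup>2 < e / 4"
    using continuous_dense_l2[OF f, of "e / 4"] \<open>e > 0\<close> by auto
  have "sqrt (e / 4) > 0" using \<open>e > 0\<close> by simp
  then obtain K p where K: "finite K" "\<And>z. z \<in> sphere 0 1 \<Longrightarrow> cmod (g z - (\<Sum>k\<in>K. p k * z powi k)) < sqrt (e / 4)"
    by (rule trig_dense_continuous[OF g(1)]) blast
  have Lg: "Linf g" by (rule Linf_continuous[OF g(1)])
  have "(l2norm (\<lambda>z. g z - (\<Sum>k\<in>K. p k * z powi k)))\<^sup>2 \<le> (sqrt (e / 4))\<^sup>2"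
    by (rule l2norm_sq_le_const; (intro Linf_diff Lg Linf_trig)?)
       (rule AE_I2, use K(2) in \<open>force intro: less_imp_le\<close>)
  also have "\<dots> = e / 4" using \<open>e > 0\<close> by simp
  finally have "(l2norm (\<lambda>z. g z - (\<Sum>k\<in>K. p k * z powi k)))\<^sup>2 \<le> e / 4" .
  moreover have "(l2norm (\<lambda>z. (f z - g z) + (g z - (\<Sum>k\<in>K. p k * z powi k))))\<^sup>2
     \<le> 2 * (l2norm (\<lambda>z. f z - g z))\<^sup>2 + 2 * (l2norm (\<lambda>z. g z - (\<Sum>k\<in>K. p k * z powi k)))\<^sup>2"
    by (rule l2norm_sq_add_le) (intro Linf_diff f Lg Linf_trig)+
  ultimately have "(l2norm (\<lambda>z. f z - (\<Sum>k\<in>K. p k * z powi k)))\<^sup>2 < e"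
    using g(2) by simp
  with K(1) show ?thesis by (rule that)
qed

text \<open>The partial sum is the best approximation by a trigonometric polynomial of the same support.\<close>
lemma parseval_partial:
  assumes f: "Linf f" and "e > 0"
  obtains K where "finite K" "\<And>K'. finite K' \<Longrightarrow> K \<subseteq> K' \<Longrightarrow> (l2norm f)\<^sup>2 - (\<Sum>k\<in>K'. (cmod (fcoef f k))\<^sup>2) < e"
proof -
  obtain K p where K: "finite K" "(l2norm (\<lambda>z. f z - (\<Sum>k\<in>K. p k * z powi k)))\<^sup>2 < e"
    by (rule trig_dense_l2[OF assms])
  have "(l2norm f)\<^sup>2 - (\<Sum>k\<in>K'. (cmod (fcoef f k))\<^sup>2) < e" if "finite K'" "K \<subseteq> K'" for K'
  proof -
    have "(\<Sum>k\<in>K. (cmod (fcoef f k))\<^sup>2) \<le> (\<Sum>k\<in>K'. (cmod (fcoef f k))\<^sup>2)"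
      using that by (intro sum_mono2) auto
    moreover have "(\<Sum>k\<in>K. (cmod (fcoef f k - p k))\<^sup>2) \<ge> 0" by (simp add: sum_nonneg)
    ultimately show ?thesis using K(2) l2norm_sq_diff_trig[OF f K(1), of p] by linarith
  qed
  with K(1) show ?thesis by (rule that)
qed

text \<open>For \<open>p = fcoef f\<close> the last sum in \<open>l2norm_sq_diff_trig\<close>
  vanishes, so the squared error of a partial sum is exactly its Parseval defect.\<close>

lemma fourier_partial_sum:
  assumes f: "Linf f" and "e > 0"
  obtains K where "finite K"
    "\<And>K'. finite K' \<Longrightarrow> K \<subseteq> K' \<Longrightarrow> (l2norm (\<lambda>z. f z - (\<Sum>k\<in>K'. fcoef f k * z powi k)))\<^sup>2 < e"
  using parseval_partial[OF assms] l2norm_sq_diff_trig[OF f, of _ "fcoef f"] by simp metis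

lemma bessel:
  assumes "Linf f" "finite K" shows "(\<Sum>k\<in>K. (cmod (fcoef f k))\<^sup>2) \<le> (l2norm f)\<^sup>2"
  using l2norm_sq_diff_trig[OF assms, of "fcoef f"]
    zero_le_power2[of "l2norm (\<lambda>z. f z - (\<Sum>k\<in>K. fcoef f k * z powi k))"] by simp

subsection \<open>Products and frequency supports\<close>

text \<open>For bounded functions this is membership in the Hardy space of the exterior disc;
  \<open>fcoef f 0\<close> is then the value at infinity.\<close>

definition freq_nonpos :: "(complex \<Rightarrow> complex) \<Rightarrow> bool" where
  "freq_nonpos f \<longleftrightarrow> (\<forall>k>0. fcoef f k = 0)"

lemma fcoef_mult_le:
  assumes "Linf f" "Linf g" "AE t in Tmeas. cmod (g (cis t)) \<le> C" "C \<ge> 0"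
  shows "cmod (fcoef (\<lambda>z. f z * g z) k) \<le> C * l2norm f"
proof -
  have "cmod (fcoef (\<lambda>z. f z * g z) k) \<le> l2norm (\<lambda>z. f z * g z)"
    using assms by (intro fcoef_le_l2norm) auto
  also have "\<dots> \<le> C * l2norm f"
  proof (rule l2norm_mono_AE)
    show "AE t in Tmeas. cmod (f (cis t) * g (cis t)) \<le> C * cmod (f (cis t))"
      using assms(3) by eventually_elim (simp add: norm_mult mult.commute[of C] mult_left_mono)
  qed (use assms in auto)
  finally show ?thesis .
qed

text \<open>Multiplicativity of the value at infinity: among nonpositive frequencies only 0 + 0
  contributes to 0. Replacing \<open>f\<close> by a partial sum makes the convolution finite, and
  boundedness of \<open>g\<close> controls the error.\<close>

lemma fcoef_zero_mult_freq_nonpos: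
  assumes f: "Linf f" and g: "Linf g" and "freq_nonpos f" "freq_nonpos g"
  shows "fcoef (\<lambda>z. f z * g z) 0 = fcoef f 0 * fcoef g 0"
proof -
  obtain C where C: "C \<ge> 0" "AE t in Tmeas. cmod (g (cis t)) \<le> C"
    using g by (rule Linf_bound)
  define D where "D = fcoef (\<lambda>z. f z * g z) 0 - fcoef f 0 * fcoef g 0"
  have "cmod D \<le> 0 + e" if "e > 0" for e
  proof -
    \<comment> \<open>The denominator is \<open>C + 1\<close> since \<open>C\<close> may be 0; the
      final error is then at most \<open>C * (e / (C + 1)) \<le> e\<close>.\<close>
    define d where "d = (e / (C + 1))\<^sup>2"
    have "d > 0" using \<open>e > 0\<close> C(1) by (auto simp: d_def)
    then obtain K where K: "finite K"
      "\<And>K'. finite K' \<Longrightarrow> K \<subseteq> K' \<Longrightarrow> (l2norm (\<lambda>z. f z - (\<Sum>k\<in>K'. fcoef f k * z powi k)))\<^sup>2 < d"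
      using fourier_partial_sum[OF f] by metis
    \<comment> \<open>Frequency 0 is added because it carries the only surviving term.\<close>
    define K' where "K' = insert 0 K"
    define P where "P = (\<lambda>z. \<Sum>k\<in>K'. fcoef f k * z powi k)"
    have fin: "finite K'" using K(1) by (simp add: K'_def)
    have P: "Linf P" unfolding P_def by (rule Linf_trig)
    have "(l2norm (\<lambda>z. f z - P z))\<^sup>2 < (e / (C + 1))\<^sup>2"
      using K(2)[of K'] fin unfolding P_def K'_def d_def by blast
    then have l2: "l2norm (\<lambda>z. f z - P z) < e / (C + 1)"
      using \<open>e > 0\<close> C(1) by (auto intro: power2_less_imp_less)
    have "fcoef (\<lambda>z. P z * g z) 0 = fcoef (\<lambda>z. \<Sum>k\<in>K'. fcoef f k * (g z * z powi k)) 0"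
      unfolding P_def by (rule fcoef_cong) (simp add: sum_distrib_left sum_distrib_right mult_ac)
    also have "\<dots> = (\<Sum>k\<in>K'. fcoef f k * fcoef g (- k))"
      by (subst fcoef_sum) (auto simp: fcoef_cmult fcoef_shift intro!: Linf_mult g)
    also have "\<dots> = (\<Sum>k\<in>K'. if k = 0 then fcoef f 0 * fcoef g 0 else 0)"
    proof (rule sum.cong)
      fix k show "fcoef f k * fcoef g (- k) = (if k = 0 then fcoef f 0 * fcoef g 0 else 0)"
        using assms(3,4) by (cases k "0::int" rule: linorder_cases) (auto simp: freq_nonpos_def)
    qed simp
    also have "\<dots> = fcoef f 0 * fcoef g 0" using fin by (simp add: K'_def)
    finally have "D = fcoef (\<lambda>z. f z * g z) 0 - fcoef (\<lambda>z. P z * g z) 0" by (simp add: D_def)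
    also have "\<dots> = fcoef (\<lambda>z. (f z - P z) * g z) 0"
      using fcoef_diff[OF Linf_mult[OF f g] Linf_mult[OF P g], of 0] by (simp add: left_diff_distrib)
    also have "cmod \<dots> \<le> C * l2norm (\<lambda>z. f z - P z)"
      by (rule fcoef_mult_le) (use f g P C in auto)
    also have "\<dots> \<le> C * (e / (C + 1))" using l2 C(1) by (intro mult_left_mono) auto
    also have "\<dots> \<le> e" using C(1) \<open>e > 0\<close> by (simp add: field_simps)
    finally show ?thesis by simp
  qed
  then have "cmod D \<le> 0" by (rule field_le_epsilon)
  then show ?thesis by (simp add: D_def)
qed

text \<open>Multiplying \<open>g\<close> by \<open>z powi (-k)\<close> moves coefficient
  \<open>k\<close> to 0 and leaves a factor with only negative frequencies, so the product formula
  at frequency 0 applies.\<close>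

lemma fcoef_mult_freq:
  assumes f: "Linf f" and g: "Linf g" and "freq_nonpos f" and "\<And>j. j \<ge> k \<Longrightarrow> fcoef g j = 0"
  shows "fcoef (\<lambda>z. f z * g z) k = 0"
proof -
  have "fcoef (\<lambda>z. f z * g z) k = fcoef (\<lambda>z. f z * (g z * z powi (-k))) 0"
    using fcoef_shift[of "\<lambda>z. f z * g z" "-k" 0] by (simp add: mult.assoc)
  also have "\<dots> = fcoef f 0 * fcoef (\<lambda>z. g z * z powi (-k)) 0"
    by (rule fcoef_zero_mult_freq_nonpos) (use assms in \<open>auto simp: freq_nonpos_def fcoef_shift\<close>)
  also have "\<dots> = 0" using assms(4)[of k] by (simp add: fcoef_shift)
  finally show ?thesis .
qed

subsection \<open>Reciprocals of bounded analytic functions\<close>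

lemma disc_power_series_holomorphic:
  assumes "\<And>w. cmod w < 1 \<Longrightarrow> (\<lambda>n. h n * w ^ n) sums H w"
  shows "H holomorphic_on ball 0 1"
  using assms by (intro power_series_holomorphic[of 0 1 h]) auto

lemma Linf_dilation:
  assumes "H holomorphic_on ball 0 1" "0 < \<rho>" "\<rho> < 1"
  shows "Linf (\<lambda>z. H (of_real \<rho> * z))"
proof (rule Linf_continuous)
  have "continuous_on (ball 0 1) H" using assms(1) by (rule holomorphic_on_imp_continuous_on)
  then show "continuous_on (sphere 0 1) (\<lambda>z. H (of_real \<rho> * z))"
    by (rule continuous_on_compose2) (use assms in \<open>auto intro!: continuous_intros simp: norm_mult\<close>)
qed

text \<open>On a circle of radius below 1 the series converges uniformly, so its Fourier
  coefficients agree with those of a long partial sum up to any \<open>e\<close>.\<close>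

lemma fcoef_dilation:
  assumes H: "\<And>w. cmod w < 1 \<Longrightarrow> (\<lambda>n. h n * w ^ n) sums H w" and \<rho>: "0 < \<rho>" "\<rho> < 1"
  shows "fcoef (\<lambda>z. H (of_real \<rho> * z)) k = (if k < 0 then 0 else h (nat k) * of_real \<rho> ^ nat k)"
    (is "?x = ?y")
proof -
  have L: "Linf (\<lambda>z. H (of_real \<rho> * z))"
    by (rule Linf_dilation[OF disc_power_series_holomorphic[OF H] \<rho>])
  have "cmod (?x - ?y) \<le> 0 + e" if "e > 0" for e
  proof -
    \<comment> \<open>Convergence at the midpoint of \<open>\<rho>\<close> and 1 gives absolute
      convergence at \<open>\<rho>\<close>.\<close>
    have "summable (\<lambda>n. cmod (h n * of_real \<rho> ^ n))"
    proof (rule powser_insidea)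
      show "summable (\<lambda>n. h n * of_real ((1 + \<rho>) / 2) ^ n)"
        using H[of "of_real ((1 + \<rho>) / 2)"] \<rho> by (auto simp: sums_iff norm_of_real simp del: of_real_divide of_real_add)
    qed (use \<rho> in \<open>auto simp del: of_real_divide of_real_add\<close>)
    then have "summable (\<lambda>n. cmod (h n) * \<rho> ^ n)"
      using \<rho> by (simp add: norm_mult norm_power)
    then have "uniform_limit (sphere 0 1) (\<lambda>N z. \<Sum>n<N. h n * (of_real \<rho> * z) ^ n) (\<lambda>z. \<Sum>n. h n * (of_real \<rho> * z) ^ n) sequentially"
      using \<rho> by (intro Weierstrass_m_test) (auto simp: norm_mult norm_power)
    then have "\<forall>\<^sub>F N in sequentially. \<forall>z\<in>sphere 0 1. dist (\<Sum>n<N. h n * (of_real \<rho> * z) ^ n) (\<Sum>n. h n * (of_real \<rho> * z) ^ n) < e"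
      using \<open>e > 0\<close> by (rule uniform_limitD)
    \<comment> \<open>The partial sum must be long enough to contain frequency
      \<open>k\<close>.\<close>
    with eventually_gt_at_top[of "nat k"] have
      "\<forall>\<^sub>F N in sequentially. nat k < N \<and> (\<forall>z\<in>sphere 0 1. dist (\<Sum>n<N. h n * (of_real \<rho> * z) ^ n) (\<Sum>n. h n * (of_real \<rho> * z) ^ n) < e)"
      by eventually_elim auto
    then obtain N where N: "nat k < N"
      "\<And>z. cmod z = 1 \<Longrightarrow> cmod ((\<Sum>n<N. h n * (of_real \<rho> * z) ^ n) - (\<Sum>n. h n * (of_real \<rho> * z) ^ n)) < e"
      by (auto simp: eventually_sequentially dist_norm)
    define P where "P = (\<lambda>z. \<Sum>n<N. (h n * of_real \<rho> ^ n) * z powi (int n))"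
    have P: "Linf P" unfolding P_def by (intro Linf_sum Linf_mult Linf_const Linf_powi)
    have "fcoef P k = (\<Sum>n<N. (h n * of_real \<rho> ^ n) * (if k = int n then 1 else 0))"
      unfolding P_def by (subst fcoef_sum) (auto simp only: fcoef_cmult fcoef_powi intro!: Linf_mult Linf_const Linf_powi)
    also have "\<dots> = (\<Sum>n<N. if nat k = n then (if k < 0 then 0 else h (nat k) * of_real \<rho> ^ nat k) else 0)"
      by (rule sum.cong) auto
    also have "\<dots> = ?y" using N(1) by simp
    finally have Pk: "fcoef P k = ?y" .
    have "?x - ?y = fcoef (\<lambda>z. H (of_real \<rho> * z) - P z) k"
      unfolding Pk[symmetric] by (rule fcoef_diff[symmetric]) (use L P in auto)
    also have "cmod \<dots> \<le> l2norm (\<lambda>z. H (of_real \<rho> * z) - P z)"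
      by (rule fcoef_le_l2norm) (use L P in auto)
    also have "\<dots> \<le> e"
    proof (rule power2_le_imp_le, rule l2norm_sq_le_const)
      have "cmod (H (of_real \<rho> * cis t) - P (cis t)) \<le> e" for t
      proof -
        have "H (of_real \<rho> * cis t) = (\<Sum>n. h n * (of_real \<rho> * cis t) ^ n)"
          using H[of "of_real \<rho> * cis t"] \<rho> by (simp add: norm_mult sums_iff)
        moreover have "P (cis t) = (\<Sum>n<N. h n * (of_real \<rho> * cis t) ^ n)"
          by (simp add: P_def power_mult_distrib mult_ac)
        ultimately show ?thesis using N(2)[of "cis t"] by (simp add: norm_minus_commute)
      qed
      then show "AE t in Tmeas. cmod (H (of_real \<rho> * cis t) - P (cis t)) \<le> e" by simp
    qed (use L P \<open>e > 0\<close> in auto)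
    finally show ?thesis by simp
  qed
  then have "cmod (?x - ?y) \<le> 0" by (rule field_le_epsilon)
  then show ?thesis by simp
qed

section \<open>Boundary values as L^2 limits of dilations\<close>

lemma ext_D_sums:
  assumes "Linf g" "cmod w < 1"
  shows "(\<lambda>n. fcoef g (int n) * w ^ n) sums ext_D g w"
proof -
  have "summable (\<lambda>n. fcoef g (int n) * w ^ n)"
  proof (rule summable_comparison_test')
    show "summable (\<lambda>n. l2norm g * cmod w ^ n)"
      using assms(2) by (intro summable_mult summable_geometric) simp
    show "norm (fcoef g (int n) * w ^ n) \<le> l2norm g * cmod w ^ n" for n
      using fcoef_le_l2norm[OF assms(1), of "int n"] by (simp add: norm_mult norm_power mult_right_mono)
  qed
  then show ?thesis unfolding ext_D_def by (rule summable_sums)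
qed

text \<open>Dilation multiplies coefficient \<open>k\<close> by \<open>\<rho> ^ k\<close>. Finitely
  many coefficients change little as \<open>\<rho>\<close> tends to 1, and the change in the others
  is bounded by the tail of \<open>g\<close>.\<close>

lemma dilation_approx:
  assumes g: "Linf g" and neg: "\<And>k. k < 0 \<Longrightarrow> fcoef g k = 0" and "e > 0"
  obtains \<rho> where "0 < \<rho>" "\<rho> < 1" "(l2norm (\<lambda>z. ext_D g (of_real \<rho> * z) - g z))\<^sup>2 < e"
proof -
  note hol = disc_power_series_holomorphic[OF ext_D_sums[OF g]]
  obtain K where K: "finite K"
    "\<And>K'. finite K' \<Longrightarrow> K \<subseteq> K' \<Longrightarrow> (l2norm g)\<^sup>2 - (\<Sum>k\<in>K'. (cmod (fcoef g k))\<^sup>2) < e / 4"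
    using parseval_partial[OF g, of "e / 4"] \<open>e > 0\<close> by auto
  \<comment> \<open>Coefficients of the dilation minus \<open>g\<close>. For negative
    \<open>k\<close> the power is \<open>\<rho> ^ 0\<close>, so the value is 0, as it should
    be.\<close>
  define d where "d = (\<lambda>\<rho> k. (of_real \<rho> ^ nat k - 1) * fcoef g k)"
  have "((\<lambda>\<rho>. \<Sum>k\<in>K. (cmod (d \<rho> k))\<^sup>2) \<longlongrightarrow> (\<Sum>k\<in>K. (cmod (d 1 k))\<^sup>2)) (at_left 1)"
    unfolding d_def by (intro tendsto_intros)
  then have "((\<lambda>\<rho>. \<Sum>k\<in>K. (cmod (d \<rho> k))\<^sup>2) \<longlongrightarrow> 0) (at_left 1)" by (simp add: d_def)
  then have "eventually (\<lambda>\<rho>. (\<Sum>k\<in>K. (cmod (d \<rho> k))\<^sup>2) < e / 4) (at_left 1)"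
    using \<open>e > 0\<close> by (intro order_tendstoD) auto
  moreover have "eventually (\<lambda>\<rho>. \<rho> \<in> {0<..<1::real}) (at_left 1)"
    by (rule eventually_at_left_real) simp
  ultimately have "eventually (\<lambda>\<rho>. \<rho> \<in> {0<..<1::real} \<and> (\<Sum>k\<in>K. (cmod (d \<rho> k))\<^sup>2) < e / 4) (at_left 1)"
    by eventually_elim auto
  then obtain \<rho> where \<rho>: "0 < \<rho>" "\<rho> < 1" "(\<Sum>k\<in>K. (cmod (d \<rho> k))\<^sup>2) < e / 4"
    using eventually_happens'[of "at_left (1::real)"] by auto
  define h where "h = (\<lambda>z. ext_D g (of_real \<rho> * z) - g z)"
  have Lh: "Linf h" unfolding h_def by (intro Linf_diff g Linf_dilation[OF hol \<rho>(1,2)])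
  have hk: "fcoef h k = d \<rho> k" for k
  proof -
    have "fcoef h k = fcoef (\<lambda>z. ext_D g (of_real \<rho> * z)) k - fcoef g k"
      unfolding h_def using g Linf_dilation[OF hol \<rho>(1,2)] by (intro fcoef_diff)
    then show ?thesis
      using fcoef_dilation[OF ext_D_sums[OF g] \<rho>(1,2), of k] neg[of k] by (auto simp: d_def algebra_simps)
  qed
  \<comment> \<open>\<open>K\<close> was fixed before \<open>\<rho>\<close>, while \<open>K2\<close>
    depends on it. Three parts below \<open>e / 4\<close> result: the defect of \<open>h\<close> on
    \<open>K \<union> K2\<close>, the change on \<open>K\<close>, and the tail of \<open>g\<close>
    on \<open>K2 - K\<close>.\<close>
  obtain K2 where K2: "finite K2"
    "\<And>K'. finite K' \<Longrightarrow> K2 \<subseteq> K' \<Longrightarrow> (l2norm h)\<^sup>2 - (\<Sum>k\<in>K'. (cmod (fcoef h k))\<^sup>2) < e / 4"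
    using parseval_partial[OF Lh, of "e / 4"] \<open>e > 0\<close> by auto
  have le: "cmod (d \<rho> k) \<le> cmod (fcoef g k)" for k
  proof -
    have "\<bar>\<rho> ^ nat k - 1\<bar> \<le> 1" using power_le_one[of \<rho> "nat k"] zero_le_power[of \<rho> "nat k"] \<rho> by linarith
    then have "cmod (of_real (\<rho> ^ nat k - 1)) \<le> 1" unfolding norm_of_real by simp
    then show ?thesis by (simp add: d_def norm_mult mult_left_le_one_le)
  qed
  have "(\<Sum>k\<in>K\<union>K2. (cmod (fcoef g k))\<^sup>2) = (\<Sum>k\<in>K. (cmod (fcoef g k))\<^sup>2) + (\<Sum>k\<in>K2-K. (cmod (fcoef g k))\<^sup>2)"
    using K(1) K2(1) by (subst sum.union_disjoint[symmetric]) (auto intro!: sum.cong)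
  then have tail: "(\<Sum>k\<in>K2-K. (cmod (fcoef g k))\<^sup>2) < e / 4"
    using bessel[OF g, of "K \<union> K2"] K(2)[of K] K(1) K2(1) by simp
  have "(\<Sum>k\<in>K\<union>K2. (cmod (fcoef h k))\<^sup>2) = (\<Sum>k\<in>K. (cmod (d \<rho> k))\<^sup>2) + (\<Sum>k\<in>K2-K. (cmod (d \<rho> k))\<^sup>2)"
    unfolding hk using K(1) K2(1) by (subst sum.union_disjoint[symmetric]) (auto intro!: sum.cong)
  moreover have "(\<Sum>k\<in>K2-K. (cmod (d \<rho> k))\<^sup>2) \<le> (\<Sum>k\<in>K2-K. (cmod (fcoef g k))\<^sup>2)"
    using le by (intro sum_mono power_mono) auto
  ultimately have "(l2norm h)\<^sup>2 < e"
    using K2(2)[of "K \<union> K2"] K(1) K2(1) \<rho>(3) tail \<open>e > 0\<close> by simp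
  then show ?thesis using \<rho> that unfolding h_def by blast
qed

lemma l2norm_zero_imp_AE:
  assumes "Linf f" "l2norm f = 0" shows "AE t in Tmeas. f (cis t) = 0"
proof -
  have "(LINT t|Tmeas. (cmod (f (cis t)))\<^sup>2) = 0"
    using l2norm_sq[of f] assms(2) by simp
  then have "AE t in Tmeas. (cmod (f (cis t)))\<^sup>2 = 0"
    by (subst (asm) integral_nonneg_eq_0_iff_AE) (use Linf_integrable_norm_sq[OF assms(1)] in auto)
  then show ?thesis by simp
qed

text \<open>Dilations satisfy the bound on the circle and tend to \<open>g\<close> in L^2. The
  deficit \<open>u\<close> is dominated pointwise by the difference from a dilation, so its norm is
  zero; no radial limits are involved.\<close>

lemma ext_D_lower_bound_boundary:
  assumes g: "Linf g" and neg: "\<And>k. k < 0 \<Longrightarrow> fcoef g k = 0"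
    and c: "c > 0" "\<And>w. cmod w < 1 \<Longrightarrow> c \<le> cmod (ext_D g w)"
  shows "AE t in Tmeas. c \<le> cmod (g (cis t))"
proof -
  note hol = disc_power_series_holomorphic[OF ext_D_sums[OF g]]
  define u where "u = (\<lambda>z. complex_of_real (max 0 (c - cmod (g z))))"
  have Lu: "Linf u"
  proof (rule Linf_I)
    show "(\<lambda>t. u (cis t)) \<in> borel_measurable Tmeas"
      unfolding u_def using Linf_measurable[OF g] by measurable
    show "AE t in Tmeas. cmod (u (cis t)) \<le> c" using c(1) by (auto simp: u_def)
  qed
  have "(l2norm u)\<^sup>2 \<le> 0 + e" if "e > 0" for e
  proof -
    obtain \<rho> where \<rho>: "0 < \<rho>" "\<rho> < 1" "(l2norm (\<lambda>z. ext_D g (of_real \<rho> * z) - g z))\<^sup>2 < e"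
      by (rule dilation_approx[OF g neg \<open>e > 0\<close>])
    have "(l2norm u)\<^sup>2 \<le> 1\<^sup>2 * (l2norm (\<lambda>z. ext_D g (of_real \<rho> * z) - g z))\<^sup>2"
    proof (rule l2norm_sq_mono_AE)
      have "cmod (u (cis t)) \<le> cmod (ext_D g (of_real \<rho> * cis t) - g (cis t))" for t
        using c(2)[of "of_real \<rho> * cis t"] \<rho> norm_triangle_ineq2[of "ext_D g (of_real \<rho> * cis t)" "g (cis t)"]
        by (simp add: u_def norm_mult del: of_real_diff)
      then show "AE t in Tmeas. cmod (u (cis t)) \<le> 1 * cmod (ext_D g (of_real \<rho> * cis t) - g (cis t))" by simp
    qed (intro Lu Linf_diff g Linf_dilation[OF hol \<rho>(1,2)])+
    with \<rho>(3) show ?thesis unfolding one_power2 mult_1 by linarith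
  qed
  then have "(l2norm u)\<^sup>2 \<le> 0" by (rule field_le_epsilon)
  then have "l2norm u = 0" by simp
  then have "AE t in Tmeas. u (cis t) = 0" by (rule l2norm_zero_imp_AE[OF Lu])
  then show ?thesis by eventually_elim (auto simp: u_def simp del: of_real_diff)
qed

lemma Linf_inverse:
  assumes "Linf g" "c > 0" "AE t in Tmeas. c \<le> cmod (g (cis t))"
  shows "Linf (\<lambda>z. inverse (g z))"
proof (rule Linf_I)
  show "AE t in Tmeas. cmod (inverse (g (cis t))) \<le> inverse c"
    using assms(3) by eventually_elim (use assms(2) in \<open>auto simp: norm_inverse intro: le_imp_inverse_le\<close>)
qed (use Linf_measurable[OF assms(1)] in measurable)

text \<open>The reciprocal of the extension is holomorphic in the disc, so its dilations have no
  negative frequencies. The lower bound \<open>c\<close> makes them converge in L^2 to the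
  reciprocal of \<open>g\<close>.\<close>

lemma fcoef_inverse_neg:
  assumes g: "Linf g" and neg: "\<And>k. k < 0 \<Longrightarrow> fcoef g k = 0"
    and c: "c > 0" "\<And>w. cmod w < 1 \<Longrightarrow> c \<le> cmod (ext_D g w)" and "k < 0"
  shows "fcoef (\<lambda>z. inverse (g z)) k = 0"
proof -
  note hol = disc_power_series_holomorphic[OF ext_D_sums[OF g]]
  have ae: "AE t in Tmeas. c \<le> cmod (g (cis t))"
    by (rule ext_D_lower_bound_boundary[OF g neg c])
  have Li: "Linf (\<lambda>z. inverse (g z))" by (rule Linf_inverse[OF g c(1) ae])
  define H where "H = (\<lambda>w. inverse (ext_D g w))"
  have holH: "H holomorphic_on ball 0 1"
    unfolding H_def
  proof (rule holomorphic_on_inverse[OF hol])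
    fix w :: complex assume "w \<in> ball 0 1"
    then have "c \<le> cmod (ext_D g w)" using c(2) by simp
    then show "ext_D g w \<noteq> 0" using c(1) by auto
  qed
  then have sumsH: "(\<lambda>n. ((deriv ^^ n) H 0 / fact n) * w ^ n) sums H w" if "cmod w < 1" for w
    using holomorphic_power_series[of H 0 1 w] that by simp
  define x where "x = fcoef (\<lambda>z. inverse (g z)) k"
  have "(cmod x)\<^sup>2 \<le> 0 + e" if "e > 0" for e
  proof -
    \<comment> \<open>Passing to reciprocals costs a factor \<open>inverse (c^2)\<close>, which is
      squared in the estimate below.\<close>
    have "e * c^4 > 0" using c(1) \<open>e > 0\<close> by simp
    then obtain \<rho> where \<rho>: "0 < \<rho>" "\<rho> < 1" "(l2norm (\<lambda>z. ext_D g (of_real \<rho> * z) - g z))\<^sup>2 < e * c^4"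
      using dilation_approx[OF g neg] by metis
    have LH: "Linf (\<lambda>z. H (of_real \<rho> * z))" by (rule Linf_dilation[OF holH \<rho>(1,2)])
    have "fcoef (\<lambda>z. H (of_real \<rho> * z)) k = 0"
      using fcoef_dilation[OF sumsH \<rho>(1,2), of k] \<open>k < 0\<close> by simp
    then have "x = fcoef (\<lambda>z. inverse (g z) - H (of_real \<rho> * z)) k"
      unfolding x_def using fcoef_diff[OF Li LH, of k] by simp
    then have "cmod x \<le> l2norm (\<lambda>z. inverse (g z) - H (of_real \<rho> * z))"
      using fcoef_le_l2norm[OF Linf_diff[OF Li LH], of k] by simp
    then have "(cmod x)\<^sup>2 \<le> (l2norm (\<lambda>z. inverse (g z) - H (of_real \<rho> * z)))\<^sup>2"
      by (rule power_mono) simp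
    also have "\<dots> \<le> (inverse (c^2))\<^sup>2 * (l2norm (\<lambda>z. ext_D g (of_real \<rho> * z) - g z))\<^sup>2"
    proof (rule l2norm_sq_mono_AE)
      show "AE t in Tmeas. cmod (inverse (g (cis t)) - H (of_real \<rho> * cis t))
          \<le> inverse (c^2) * cmod (ext_D g (of_real \<rho> * cis t) - g (cis t))"
        using ae
      proof eventually_elim
        case (elim t)
        define u v where "u = g (cis t)" and "v = ext_D g (of_real \<rho> * cis t)"
        have uv: "c \<le> cmod u" "c \<le> cmod v" using elim c(2)[of "of_real \<rho> * cis t"] \<rho> by (auto simp: u_def v_def norm_mult)
        then have "u \<noteq> 0" "v \<noteq> 0" using c(1) by auto
        then have "inverse u - inverse v = inverse (u * v) * (v - u)" by (simp add: field_simps)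
        then have "cmod (inverse u - inverse v) = inverse (cmod u * cmod v) * cmod (v - u)"
          by (simp add: norm_mult norm_inverse)
        also have "\<dots> \<le> inverse (c^2) * cmod (v - u)"
          using uv c(1) by (intro mult_right_mono le_imp_inverse_le) (auto simp: power2_eq_square intro: mult_mono)
        finally show ?case by (simp add: u_def v_def H_def)
      qed
    qed (intro Linf_diff Li LH g Linf_dilation[OF hol \<rho>(1,2)])+
    also have "\<dots> \<le> (inverse (c^2))\<^sup>2 * (e * c^4)" using \<rho>(3) by (intro mult_left_mono) auto
    also have "\<dots> = e" using c(1) by (simp add: field_simps eval_nat_numeral)
    finally show ?thesis by simp
  qed
  then have "(cmod x)\<^sup>2 \<le> 0" by (rule field_le_epsilon)
  then show ?thesis by (simp add: x_def)
qed

subsection \<open>Frequency supports of the two half-line factors\<close>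

lemma Lspace_Linf:
  assumes "(a, b) \<in> Lspace"
  shows "Linf a" "Linf b"
    "AE t in Tmeas. a (cis t) * cnj (a (cis t)) + b (cis t) * cnj (b (cis t)) = 1"
    "AE t in Tmeas. cmod (a (cis t)) \<le> 1"
proof -
  show ae: "AE t in Tmeas. a (cis t) * cnj (a (cis t)) + b (cis t) * cnj (b (cis t)) = 1"
    using assms unfolding Lspace_def by simp
  have sq: "AE t in Tmeas. (cmod (a (cis t)))\<^sup>2 + (cmod (b (cis t)))\<^sup>2 = 1"
    using ae
  proof eventually_elim
    case (elim t)
    then have "complex_of_real ((cmod (a (cis t)))\<^sup>2 + (cmod (b (cis t)))\<^sup>2) = 1"
      by (simp add: complex_norm_square[symmetric])
    then show ?case using of_real_eq_1_iff by blast
  qed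
  show a1: "AE t in Tmeas. cmod (a (cis t)) \<le> 1"
    using sq by eventually_elim (metis le_add_same_cancel1 norm_ge_zero one_power2 power2_le_imp_le zero_le_one zero_le_power2)
  moreover have "AE t in Tmeas. cmod (b (cis t)) \<le> 1"
    using sq by eventually_elim (metis le_add_same_cancel2 norm_ge_zero one_power2 power2_le_imp_le zero_le_one zero_le_power2)
  ultimately show "Linf a" "Linf b" using assms unfolding Lspace_def by (auto intro: Linf_I)
qed

lemma at_inf_eq_fcoef: "at_inf f = fcoef f 0"
  by (simp add: at_inf_def fcoef_star)

lemma Lspace_freq_nonpos: "(a, b) \<in> Lspace \<Longrightarrow> freq_nonpos a"
proof -
  assume "(a, b) \<in> Lspace"
  then have *: "fcoef (star a) k = 0" if "k < 0" for k
    using that by (auto simp: Lspace_def H2_Dstar_def H2_D_def)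
  have "fcoef a k = 0" if "k > 0" for k
    using *[of "-k"] that by (simp add: fcoef_star)
  then show ?thesis by (simp add: freq_nonpos_def)
qed

section \<open>Finite ordered products\<close>

text \<open>One step of the transfer-matrix recursion on Fourier coefficients: \<open>star\<close>
  reverses frequencies and \<open>z powi k\<close> shifts them, so \<open>j\<close> is coupled to
  \<open>k - j\<close>.\<close>

lemma pmul_nlf_factor:
  fixes a b :: "complex \<Rightarrow> complex" and G :: "int \<Rightarrow> complex" and k j :: int
  assumes a: "Linf a" and b: "Linf b"
  defines "\<alpha> \<equiv> complex_of_real (1 / sqrt (1 + (cmod (G k))\<^sup>2))"
  defines "P \<equiv> pmul (nlf_factor G k) (a, b)"
  shows "Linf (fst P)" "Linf (snd P)"
    "fcoef (fst P) j = \<alpha> * fcoef a j - \<alpha> * G k * cnj (fcoef b (k - j))"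
    "fcoef (snd P) j = \<alpha> * fcoef b j + \<alpha> * G k * cnj (fcoef a (k - j))"
proof -
  have 1: "fst P = (\<lambda>z. \<alpha> * a z - \<alpha> * G k * (star b z * z powi k))"
    and 2: "snd P = (\<lambda>z. \<alpha> * b z + \<alpha> * G k * (star a z * z powi k))"
    by (simp_all add: P_def pmul_def nlf_factor_def \<alpha>_def mult_ac)
  have L: "Linf (\<lambda>z. \<alpha> * a z)" "Linf (\<lambda>z. \<alpha> * G k * (star b z * z powi k))"
     "Linf (\<lambda>z. \<alpha> * b z)" "Linf (\<lambda>z. \<alpha> * G k * (star a z * z powi k))"
    by (intro Linf_mult Linf_const Linf_powi Linf_star a b)+
  show "Linf (fst P)" "Linf (snd P)"
    unfolding 1 2 by (rule Linf_diff[OF L(1,2)], rule Linf_add[OF L(3,4)])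
  show "fcoef (fst P) j = \<alpha> * fcoef a j - \<alpha> * G k * cnj (fcoef b (k - j))"
    unfolding 1 fcoef_diff[OF L(1,2)] by (simp only: fcoef_cmult fcoef_shift fcoef_star minus_diff_eq)
  show "fcoef (snd P) j = \<alpha> * fcoef b j + \<alpha> * G k * cnj (fcoef a (k - j))"
    unfolding 2 fcoef_add[OF L(3,4)] by (simp only: fcoef_cmult fcoef_shift fcoef_star minus_diff_eq)
qed

text \<open>The product of \<open>nlfs_fin\<close> over an explicit list, to allow list
  induction.\<close>

definition nlfs_list :: "(int \<Rightarrow> complex) \<Rightarrow> int list \<Rightarrow> cpair" where
  "nlfs_list G ks = foldr (\<lambda>k acc. pmul (nlf_factor G k) acc) ks pone"

lemma fcoef_const: "fcoef (\<lambda>_. c) k = (if k = 0 then c else 0)"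
  using fcoef_cmult[of c "\<lambda>z. 1" k] fcoef_powi[of 0 k] by simp

text \<open>Prepending \<open>k\<close> to a list in \<open>{k + 1..m}\<close> reflects the supports
  by \<open>j \<mapsto> k - j\<close>, which keeps them in the stated ranges. Frequency 0 is
  exempted because of the empty list: there \<open>l - m\<close> may be positive while
  \<open>pone\<close> has coefficient 1 at 0.\<close>

lemma nlfs_list_support:
  assumes "sorted_wrt (<) ks" "set ks \<subseteq> {l..m}"
  shows "Linf (fst (nlfs_list G ks)) \<and> Linf (snd (nlfs_list G ks)) \<and>
    (\<forall>j. j > 0 \<or> (j < l - m \<and> j \<noteq> 0) \<longrightarrow> fcoef (fst (nlfs_list G ks)) j = 0) \<and>
    (\<forall>j. j \<notin> {l..m} \<longrightarrow> fcoef (snd (nlfs_list G ks)) j = 0)"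
  using assms
proof (induction ks arbitrary: l)
  case Nil
  then show ?case by (auto simp: nlfs_list_def pone_def fcoef_const)
next
  case (Cons k ks)
  define a b where "a = fst (nlfs_list G ks)" and "b = snd (nlfs_list G ks)"
  have eq: "nlfs_list G (k # ks) = pmul (nlf_factor G k) (a, b)"
    by (simp add: nlfs_list_def a_def b_def)
  have IH: "Linf a" "Linf b" "\<And>j. j > 0 \<or> (j < (k + 1) - m \<and> j \<noteq> 0) \<Longrightarrow> fcoef a j = 0"
    "\<And>j. j \<notin> {k + 1..m} \<Longrightarrow> fcoef b j = 0"
    using Cons.IH[of "k + 1"] Cons.prems by (force simp: a_def b_def)+
  have k: "l \<le> k" "k \<le> m" using Cons.prems by auto
  have "fcoef a j = 0 \<and> fcoef b (k - j) = 0" if "j > 0 \<or> (j < l - m \<and> j \<noteq> 0)" for j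
    using that k by (intro conjI IH(3,4)) auto
  moreover have "fcoef b j = 0 \<and> fcoef a (k - j) = 0" if "j \<notin> {l..m}" for j
    using that k by (intro conjI IH(3,4)) auto
  ultimately show ?case
    unfolding eq using pmul_nlf_factor[OF IH(1,2), of G k] by simp
qed

text \<open>Layer stripping: if 0 occurs it heads the list, and the remaining product has no
  frequency 0 in its second component. The recursion then gives
  \<open>\<alpha> * G 0 * cnj a0\<close> and \<open>\<alpha> * a0\<close> with the same real
  \<open>\<alpha>\<close>, where \<open>a0\<close> is the zeroth coefficient of the remaining first
  component.\<close>

lemma nlfs_list_zero_coeff:
  assumes "sorted_wrt (<) ks" "set ks \<subseteq> {0..m}" "0 \<notin> set ks \<Longrightarrow> G 0 = 0"
  shows "fcoef (snd (nlfs_list G ks)) 0 = G 0 * cnj (fcoef (fst (nlfs_list G ks)) 0)"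
proof (cases "0 \<in> set ks")
  case False
  then have "k \<noteq> 0" "0 \<le> k" "k \<le> m" if "k \<in> set ks" for k using assms(2) that by auto
  then have "set ks \<subseteq> {1..m}" by force
  from nlfs_list_support[OF assms(1) this, of G] False assms(3) show ?thesis by simp
next
  case True
  then obtain k ks' where ks: "ks = k # ks'" by (cases ks) auto
  have "k = 0"
    using True assms(1,2) unfolding ks by force
  have "set ks' \<subseteq> {1..m}" using assms(1,2) unfolding ks \<open>k = 0\<close> by force
  define a b where "a = fst (nlfs_list G ks')" and "b = snd (nlfs_list G ks')"
  have eq: "nlfs_list G ks = pmul (nlf_factor G 0) (a, b)"
    by (simp add: nlfs_list_def a_def b_def ks \<open>k = 0\<close>)
  have "sorted_wrt (<) ks'" using assms(1) ks by simp
  then have "Linf a" "Linf b" "fcoef b 0 = 0"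
    using nlfs_list_support[OF _ \<open>set ks' \<subseteq> {1..m}\<close>, of G] by (auto simp: a_def b_def)
  then show ?thesis
    unfolding eq using pmul_nlf_factor(3,4)[of a b G 0 0] by simp
qed

lemma nlfs_fin_eq_nlfs_list:
  assumes "\<And>k. G k \<noteq> 0 \<Longrightarrow> k \<in> {l..m}"
  obtains ks where "nlfs_fin G = nlfs_list G ks" "sorted_wrt (<) ks" "set ks \<subseteq> {l..m}" "set ks = {k. G k \<noteq> 0}"
proof -
  have "finite {k. G k \<noteq> 0}" by (rule finite_subset[of _ "{l..m}"]) (use assms in auto)
  then show ?thesis
    using assms by (intro that[of "sorted_list_of_set {k. G k \<noteq> 0}"]) (auto simp: nlfs_fin_def nlfs_list_def)
qed

section \<open>Passage to square-summable sequences\<close>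

text \<open>\<open>rho\<close> dominates both L^2 distances, and each Fourier coefficient is
  1-Lipschitz in the L^2 norm.\<close>

lemma rho_limit_fcoef:
  assumes lim: "rho_limit S P" and L: "\<And>n. Linf (fst (S n))" "\<And>n. Linf (snd (S n))"
  shows "(\<lambda>n. fcoef (fst (S n)) k) \<longlonglongrightarrow> fcoef (fst P) k" "(\<lambda>n. fcoef (snd (S n)) k) \<longlonglongrightarrow> fcoef (snd P) k"
proof -
  obtain a b where P: "P = (a, b)" by (cases P)
  have "(a, b) \<in> Lspace" and rho: "(\<lambda>k. rho (S k) P) \<longlonglongrightarrow> 0"
    using lim by (auto simp: rho_limit_def P)
  from Lspace_Linf[OF this(1)] have LP: "Linf (fst P)" "Linf (snd P)" by (simp_all add: P)
  have "cmod (fcoef (fst (S n)) k - fcoef (fst P) k) \<le> rho (S n) P" for n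
  proof -
    have "cmod (fcoef (fst (S n)) k - fcoef (fst P) k) \<le> l2norm (\<lambda>z. fst (S n) z - fst P z)"
      unfolding fcoef_diff[OF L(1) LP(1), symmetric] by (rule fcoef_le_l2norm[OF Linf_diff[OF L(1) LP(1)]])
    moreover have "l2norm (\<lambda>z. snd (S n) z - snd P z) \<ge> 0" by simp
    ultimately show ?thesis unfolding rho_def by linarith
  qed
  then have "(\<lambda>n. fcoef (fst (S n)) k - fcoef (fst P) k) \<longlonglongrightarrow> 0"
    by (intro Lim_null_comparison[OF _ rho]) auto
  then show "(\<lambda>n. fcoef (fst (S n)) k) \<longlonglongrightarrow> fcoef (fst P) k" by (simp add: LIM_zero_iff)
  have "cmod (fcoef (snd (S n)) k - fcoef (snd P) k) \<le> rho (S n) P" for n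
  proof -
    have "cmod (fcoef (snd (S n)) k - fcoef (snd P) k) \<le> l2norm (\<lambda>z. snd (S n) z - snd P z)"
      unfolding fcoef_diff[OF L(2) LP(2), symmetric] by (rule fcoef_le_l2norm[OF Linf_diff[OF L(2) LP(2)]])
    moreover have "l2norm (\<lambda>z. fst (S n) z - fst P z) \<ge> 0" by simp
    ultimately show ?thesis unfolding rho_def by linarith
  qed
  then have "(\<lambda>n. fcoef (snd (S n)) k - fcoef (snd P) k) \<longlonglongrightarrow> 0"
    by (intro Lim_null_comparison[OF _ rho]) auto
  then show "(\<lambda>n. fcoef (snd (S n)) k) \<longlonglongrightarrow> fcoef (snd P) k" by (simp add: LIM_zero_iff)
qed

text \<open>The support conditions and the formula for \<open>F 0\<close> hold for every truncation
  and are closed conditions on single coefficients, so they survive the limit.\<close>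

lemma is_nlfs_factorization:
  assumes "is_nlfs F (a, b)"
  obtains ap bp am bm where "(ap, bp) \<in> Lspace" "(am, bm) \<in> Lspace"
    "\<And>k. k < 0 \<Longrightarrow> fcoef bp k = 0" "\<And>k. k \<ge> 0 \<Longrightarrow> fcoef bm k = 0"
    "fcoef bp 0 = F 0 * cnj (fcoef ap 0)"
    "AE t in Tmeas. a (cis t) = am (cis t) * ap (cis t) - bm (cis t) * cnj (bp (cis t))
                  \<and> b (cis t) = am (cis t) * bp (cis t) + bm (cis t) * cnj (ap (cis t))"
proof -
  define Fp where "Fp = (\<lambda>n j. if 0 \<le> j \<and> j \<le> int n then F j else 0)"
  define Fm where "Fm = (\<lambda>n j. if - int n \<le> j \<and> j \<le> -1 then F j else 0)"
  obtain ap bp am bm where lp: "rho_limit (\<lambda>n. nlfs_fin (Fp n)) (ap, bp)"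
    and lm: "rho_limit (\<lambda>n. nlfs_fin (Fm n)) (am, bm)"
    and ae: "AE t in Tmeas. a (cis t) = fst (pmul (am, bm) (ap, bp)) (cis t) \<and> b (cis t) = snd (pmul (am, bm) (ap, bp)) (cis t)"
    using assms unfolding is_nlfs_def Fp_def Fm_def by auto
  have p: "Linf (fst (nlfs_fin (Fp n)))" "Linf (snd (nlfs_fin (Fp n)))"
    "k < 0 \<Longrightarrow> fcoef (snd (nlfs_fin (Fp n))) k = 0"
    "fcoef (snd (nlfs_fin (Fp n))) 0 = F 0 * cnj (fcoef (fst (nlfs_fin (Fp n))) 0)" for n k
  proof -
    obtain ks where ks: "nlfs_fin (Fp n) = nlfs_list (Fp n) ks" "sorted_wrt (<) ks" "set ks \<subseteq> {0..int n}"
      "set ks = {k. Fp n k \<noteq> 0}"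
      by (rule nlfs_fin_eq_nlfs_list[of "Fp n" 0 "int n"]) (auto simp: Fp_def split: if_splits)
    note * = nlfs_list_support[OF ks(2,3), of "Fp n", folded ks(1)]
    from * show "Linf (fst (nlfs_fin (Fp n)))" "Linf (snd (nlfs_fin (Fp n)))"
      "k < 0 \<Longrightarrow> fcoef (snd (nlfs_fin (Fp n))) k = 0" by auto
    \<comment> \<open>Every truncation, even \<open>n = 0\<close>, keeps the entry at 0, so the
      factor \<open>F 0\<close> does not vary along the limit.\<close>
    have "Fp n 0 = F 0" by (simp add: Fp_def)
    then show "fcoef (snd (nlfs_fin (Fp n))) 0 = F 0 * cnj (fcoef (fst (nlfs_fin (Fp n))) 0)"
      using nlfs_list_zero_coeff[OF ks(2,3), of "Fp n"] ks(4) unfolding ks(1) by simp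
  qed
  have m: "Linf (fst (nlfs_fin (Fm n)))" "Linf (snd (nlfs_fin (Fm n)))"
    "k \<ge> 0 \<Longrightarrow> fcoef (snd (nlfs_fin (Fm n))) k = 0" for n k
  proof -
    obtain ks where ks: "nlfs_fin (Fm n) = nlfs_list (Fm n) ks" "sorted_wrt (<) ks" "set ks \<subseteq> {- int n..-1}"
      by (rule nlfs_fin_eq_nlfs_list[of "Fm n" "- int n" "-1"]) (auto simp: Fm_def split: if_splits)
    note * = nlfs_list_support[OF ks(2,3), of "Fm n", folded ks(1)]
    from * show "Linf (fst (nlfs_fin (Fm n)))" "Linf (snd (nlfs_fin (Fm n)))"
      "k \<ge> 0 \<Longrightarrow> fcoef (snd (nlfs_fin (Fm n))) k = 0" by auto
  qed
  note limp = rho_limit_fcoef[OF lp p(1,2), unfolded fst_conv snd_conv]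
  note limm = rho_limit_fcoef[OF lm m(1,2), unfolded fst_conv snd_conv]
  show ?thesis
  proof (rule that[of ap bp am bm])
    show "(ap, bp) \<in> Lspace" "(am, bm) \<in> Lspace" using lp lm by (auto simp: rho_limit_def)
    show "fcoef bp k = 0" if "k < 0" for k
      using limp(2)[of k] that by (simp add: p(3) LIMSEQ_const_iff)
    show "fcoef bm k = 0" if "k \<ge> 0" for k
      using limm(2)[of k] that by (simp add: m(3) LIMSEQ_const_iff)
    have "(\<lambda>n. F 0 * cnj (fcoef (fst (nlfs_fin (Fp n))) 0)) \<longlonglongrightarrow> F 0 * cnj (fcoef ap 0)"
      by (intro tendsto_intros limp)
    with limp(2)[of 0] show "fcoef bp 0 = F 0 * cnj (fcoef ap 0)"
      unfolding p(4) by (rule LIMSEQ_unique)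
    show "AE t in Tmeas. a (cis t) = am (cis t) * ap (cis t) - bm (cis t) * cnj (bp (cis t))
                  \<and> b (cis t) = am (cis t) * bp (cis t) + bm (cis t) * cnj (ap (cis t))"
      using ae by (simp add: pmul_def)
  qed
qed

subsection \<open>The Riemann-Hilbert problem and its stability\<close>

text \<open>Integrates a pointwise quadratic bound. It is applied once to absorb a cross term and
  once to compare the reflection quotients.\<close>

lemma T_int_sq_mono:
  assumes "Linf W" "Linf u" "Linf v" "Linf w"
    "AE t in Tmeas. cmod (W (cis t)) \<le> p * (cmod (u (cis t)))\<^sup>2 + q * ((cmod (v (cis t)))\<^sup>2 + (cmod (w (cis t)))\<^sup>2)"
  shows "cmod (T_int W) \<le> p * (l2norm u)\<^sup>2 + q * ((l2norm v)\<^sup>2 + (l2norm w)\<^sup>2)"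
proof -
  note i = assms(2-4)[THEN Linf_integrable_norm_sq]
  have "cmod (LINT t|Tmeas. W (cis t)) \<le> (LINT t|Tmeas. cmod (W (cis t)))"
    by (rule integral_norm_bound)
  also have "\<dots> \<le> (LINT t|Tmeas. p * (cmod (u (cis t)))\<^sup>2 + q * ((cmod (v (cis t)))\<^sup>2 + (cmod (w (cis t)))\<^sup>2))"
    using assms(5) by (rule integral_mono_AE[rotated 2]) (use i Linf_integrable[OF assms(1)] in auto)
  also have "\<dots> = p * (LINT t|Tmeas. (cmod (u (cis t)))\<^sup>2) + q * ((LINT t|Tmeas. (cmod (v (cis t)))\<^sup>2) + (LINT t|Tmeas. (cmod (w (cis t)))\<^sup>2))"
    using i by simp
  finally have "(1 / (2*pi)) * cmod (LINT t|Tmeas. W (cis t)) \<le> (1 / (2*pi)) * (p * (LINT t|Tmeas. (cmod (u (cis t)))\<^sup>2) + q * ((LINT t|Tmeas. (cmod (v (cis t)))\<^sup>2) + (LINT t|Tmeas. (cmod (w (cis t)))\<^sup>2)))"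
    by (rule mult_left_mono) simp
  moreover have "cmod (T_int W) = (1 / (2*pi)) * cmod (LINT t|Tmeas. W (cis t))"
    unfolding T_int_def norm_mult norm_of_real by simp
  ultimately show ?thesis unfolding l2norm_sq by (simp add: algebra_simps)
qed

lemma inf_abs_Dstar_le:
  shows "inf_abs_Dstar a \<le> cmod (at_inf a)" "cmod w > 1 \<Longrightarrow> inf_abs_Dstar a \<le> cmod (ext_Dstar a w)"
  unfolding inf_abs_Dstar_def by (rule cInf_lower; force intro: bdd_belowI[of _ 0])+

text \<open>Inversion in the circle carries the punctured disc to the finite exterior points; the
  center corresponds to infinity and is treated separately.\<close>

lemma ext_D_star_lower_bound:
  assumes "Linf a" "c \<le> inf_abs_Dstar a" "cmod w < 1"
  shows "c \<le> cmod (ext_D (star a) w)"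
proof (cases "w = 0")
  case True
  have "ext_D (star a) 0 = fcoef (star a) 0"
    using ext_D_sums[OF Linf_star[OF assms(1)], of 0] by (auto simp: ext_D_def)
  then show ?thesis using inf_abs_Dstar_le(1)[of a] assms(2) True by (simp add: at_inf_def)
next
  case False
  then have "cmod (inverse (cnj w)) > 1" using assms(3) by (simp add: norm_inverse one_less_inverse)
  from inf_abs_Dstar_le(2)[OF this, of a] assms(2) show ?thesis by (simp add: ext_Dstar_def)
qed

text \<open>Dividing by the value of \<open>ap\<close> at infinity fixes
  \<open>fcoef A 0 = 1\<close>, so that differences of two solutions lose their frequency 0. That
  value has modulus at least \<open>1 / sqrt 2\<close>, whence the pointwise bound 2.\<close>

lemma riemann_hilbert:
  assumes ab: "(a, b) \<in> Lspace" and inf: "1 / sqrt 2 \<le> inf_abs_Dstar a" and F: "is_nlfs F (a, b)"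
  obtains A B where "Linf A" "Linf B" "freq_nonpos A" "fcoef A 0 = 1"
    "\<And>k. k < 0 \<Longrightarrow> fcoef B k = 0" "fcoef B 0 = F 0"
    "AE t in Tmeas. (cmod (A (cis t)))\<^sup>2 + (cmod (B (cis t)))\<^sup>2 \<le> 2"
    "\<And>k. k \<ge> 0 \<Longrightarrow> fcoef (\<lambda>z. B z - b z * inverse (a z) * A z) k = 0"
    "\<And>k. k > 0 \<Longrightarrow> fcoef (\<lambda>z. cnj (A z) + b z * inverse (a z) * cnj (B z)) k = 0"
    "Linf (\<lambda>z. inverse (a z))" "AE t in Tmeas. 1 / sqrt 2 \<le> cmod (a (cis t))"
proof -
  obtain ap bp am bm where p: "(ap, bp) \<in> Lspace" and m: "(am, bm) \<in> Lspace"
    and bp: "\<And>k. k < 0 \<Longrightarrow> fcoef bp k = 0" and bm: "\<And>k. k \<ge> 0 \<Longrightarrow> fcoef bm k = 0"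
    and F0: "fcoef bp 0 = F 0 * cnj (fcoef ap 0)"
    and ae: "AE t in Tmeas. a (cis t) = am (cis t) * ap (cis t) - bm (cis t) * cnj (bp (cis t))
                  \<and> b (cis t) = am (cis t) * bp (cis t) + bm (cis t) * cnj (ap (cis t))"
    using is_nlfs_factorization[OF F] by blast
  note La = Lspace_Linf(1)[OF ab] and Lb = Lspace_Linf(2)[OF ab]
    and Lap = Lspace_Linf(1)[OF p] and Lbp = Lspace_Linf(2)[OF p]
    and Lam = Lspace_Linf(1)[OF m] and Lbm = Lspace_Linf(2)[OF m]
  define c :: real where "c = 1 / sqrt 2"
  have c: "c > 0" "c\<^sup>2 = 1 / 2" by (simp_all add: c_def power_divide)
  have neg: "fcoef (star a) k = 0" if "k < 0" for k
    using Lspace_freq_nonpos[OF ab] that by (simp add: fcoef_star freq_nonpos_def)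
  have low: "c \<le> cmod (ext_D (star a) w)" if "cmod w < 1" for w
    using ext_D_star_lower_bound[OF La _ that] inf by (simp add: c_def)
  have ca: "AE t in Tmeas. c \<le> cmod (a (cis t))"
    using ext_D_lower_bound_boundary[OF Linf_star[OF La] neg c(1) low] by simp
  have Li: "Linf (\<lambda>z. inverse (a z))" by (rule Linf_inverse[OF La c(1) ca])
  have ifreq: "freq_nonpos (\<lambda>z. inverse (a z))"
    unfolding freq_nonpos_def
  proof safe
    fix k :: int assume "k > 0"
    \<comment> \<open>The reciprocal is handled inside the disc, for \<open>star a\<close>, and
      reflected back.\<close>
    have "fcoef (\<lambda>z. inverse (a z)) k = fcoef (star (\<lambda>z. inverse (star a z))) k"
      by (rule fcoef_cong) simp
    also have "\<dots> = cnj (fcoef (\<lambda>z. inverse (star a z)) (-k))" by (rule fcoef_star)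
    also have "fcoef (\<lambda>z. inverse (star a z)) (-k) = 0"
      using fcoef_inverse_neg[OF Linf_star[OF La] neg c(1) low, of "-k"] \<open>k > 0\<close> by simp
    finally show "fcoef (\<lambda>z. inverse (a z)) k = 0" by simp
  qed
  define \<kappa> where "\<kappa> = fcoef ap 0"
  have \<kappa>: "Im \<kappa> = 0" using p by (simp add: \<kappa>_def at_inf_eq_fcoef Lspace_def)
  \<comment> \<open>At infinity \<open>a\<close> equals \<open>am\<close> times \<open>ap\<close>,
    since the term with \<open>bm\<close> has only negative frequencies; and the value of
    \<open>am\<close> there has modulus at most 1.\<close>
  have "c \<le> cmod \<kappa>"
  proof -
    have "c \<le> cmod (fcoef a 0)" using inf_abs_Dstar_le(1)[of a] inf by (simp add: at_inf_eq_fcoef c_def)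
    also have "fcoef a 0 = fcoef (\<lambda>z. am z * ap z - cnj (bp z) * bm z) 0"
      by (rule fcoef_cong_AE)
         (use ae in \<open>auto simp: mult.commute intro!: La Linf_diff Linf_mult Linf_cnj Lam Lap Lbp Lbm elim: eventually_mono\<close>)
    also have "\<dots> = fcoef (\<lambda>z. am z * ap z) 0 - fcoef (\<lambda>z. cnj (bp z) * bm z) 0"
      by (rule fcoef_diff) (intro Linf_mult Linf_cnj Lam Lap Lbp Lbm)+
    also have "fcoef (\<lambda>z. cnj (bp z) * bm z) 0 = 0"
      by (rule fcoef_mult_freq) (auto simp: freq_nonpos_def fcoef_cnj bp bm intro: Lbp Lbm)
    also have "fcoef (\<lambda>z. am z * ap z) 0 = fcoef am 0 * \<kappa>"
      unfolding \<kappa>_def by (rule fcoef_zero_mult_freq_nonpos[OF Lam Lap Lspace_freq_nonpos[OF m] Lspace_freq_nonpos[OF p]])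
    also have "cmod (fcoef am 0 * \<kappa> - 0) \<le> 1 * cmod \<kappa>"
    proof -
      have "(l2norm am)\<^sup>2 \<le> 1\<^sup>2" by (rule l2norm_sq_le_const[OF Lam Lspace_Linf(4)[OF m]])
      then have "l2norm am \<le> 1" by (rule power2_le_imp_le) simp
      then have "cmod (fcoef am 0) \<le> 1" using fcoef_le_l2norm[OF Lam, of 0] by linarith
      then show ?thesis unfolding diff_zero norm_mult by (intro mult_right_mono) auto
    qed
    finally show ?thesis by simp
  qed
  then have \<kappa>0: "\<kappa> \<noteq> 0" using c(1) by auto
  have cnj\<kappa>: "cnj \<kappa> = \<kappa>" using \<kappa> by (simp add: complex_eq_iff)
  define A B where "A = (\<lambda>z. inverse \<kappa> * ap z)" and "B = (\<lambda>z. inverse \<kappa> * bp z)"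
  have LA: "Linf A" and LB: "Linf B" unfolding A_def B_def by (intro Linf_mult Linf_const Lap Lbp)+
  have Lr: "Linf (\<lambda>z. b z * inverse (a z))" by (intro Linf_mult Lb Li)
  have pn: "AE t in Tmeas. ap (cis t) * cnj (ap (cis t)) + bp (cis t) * cnj (bp (cis t)) = 1"
    by (rule Lspace_Linf(3)[OF p])
  have anz: "AE t in Tmeas. a (cis t) \<noteq> 0" using ca by eventually_elim (use c(1) in auto)
  show ?thesis
  proof (rule that[OF LA LB _ _ _ _ _ _ _ Li])
    show "freq_nonpos A" using Lspace_freq_nonpos[OF p] by (simp add: freq_nonpos_def A_def fcoef_cmult)
    show "fcoef A 0 = 1" using \<kappa>0 by (simp add: A_def fcoef_cmult \<kappa>_def)
    show "fcoef B k = 0" if "k < 0" for k using bp[OF that] by (simp add: B_def fcoef_cmult)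
    show "fcoef B 0 = F 0" using \<kappa>0 cnj\<kappa> unfolding B_def fcoef_cmult F0 \<kappa>_def by simp
    show "AE t in Tmeas. (cmod (A (cis t)))\<^sup>2 + (cmod (B (cis t)))\<^sup>2 \<le> 2"
      using pn
    proof eventually_elim
      case (elim t)
      then have "complex_of_real ((cmod (ap (cis t)))\<^sup>2 + (cmod (bp (cis t)))\<^sup>2) = 1"
        by (simp add: complex_norm_square[symmetric])
      then have 1: "(cmod (ap (cis t)))\<^sup>2 + (cmod (bp (cis t)))\<^sup>2 = 1" using of_real_eq_1_iff by blast
      have "(cmod (A (cis t)))\<^sup>2 + (cmod (B (cis t)))\<^sup>2 = (inverse (cmod \<kappa>))\<^sup>2 * ((cmod (ap (cis t)))\<^sup>2 + (cmod (bp (cis t)))\<^sup>2)"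
        by (simp add: A_def B_def norm_mult norm_inverse power_mult_distrib ring_distribs)
      also have "\<dots> = inverse ((cmod \<kappa>)\<^sup>2)" unfolding 1 by (simp add: power_inverse)
      also have "\<dots> \<le> inverse (c\<^sup>2)"
        using \<open>c \<le> cmod \<kappa>\<close> c(1) by (intro le_imp_inverse_le power_mono) auto
      finally show ?case unfolding c(2) by simp
    qed
    show "AE t in Tmeas. 1 / sqrt 2 \<le> cmod (a (cis t))" using ca by (simp add: c_def)
    show "fcoef (\<lambda>z. B z - b z * inverse (a z) * A z) k = 0" if "k \<ge> 0" for k
    proof -
      have "fcoef (\<lambda>z. B z - b z * inverse (a z) * A z) k = fcoef (\<lambda>z. - inverse \<kappa> * (inverse (a z) * bm z)) k"
      proof (rule fcoef_cong_AE)
        show "AE t in Tmeas. B (cis t) - b (cis t) * inverse (a (cis t)) * A (cis t)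
            = - inverse \<kappa> * (inverse (a (cis t)) * bm (cis t))"
          using ae pn anz
        proof eventually_elim
          case (elim t)
          \<comment> \<open>The pair \<open>(ap, bp)\<close> is the first row of a unitary matrix of
            determinant 1, so the factorization can be solved for \<open>bm\<close>, and likewise
            for \<open>am\<close> below.\<close>
          have "b (cis t) * ap (cis t) - a (cis t) * bp (cis t)
             = bm (cis t) * (ap (cis t) * cnj (ap (cis t)) + bp (cis t) * cnj (bp (cis t)))"
            unfolding conjunct1[OF elim(1)] conjunct2[OF elim(1)] by (simp add: algebra_simps)
          then have bm_eq: "bm (cis t) = b (cis t) * ap (cis t) - a (cis t) * bp (cis t)" using elim(2) by simp
          show ?case unfolding bm_eq using elim(3) \<kappa>0 by (simp add: A_def B_def field_simps)
        qed
      qed (intro Linf_diff Linf_mult Linf_const LA LB Lr Li Lbm)+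
      \<comment> \<open>A factor with nonpositive frequencies times one with negative
        frequencies.\<close>
      also have "\<dots> = 0"
        unfolding fcoef_cmult using fcoef_mult_freq[OF Li Lbm ifreq, of k] bm that by simp
      finally show ?thesis .
    qed
    show "fcoef (\<lambda>z. cnj (A z) + b z * inverse (a z) * cnj (B z)) k = 0" if "k > 0" for k
    proof -
      have "fcoef (\<lambda>z. cnj (A z) + b z * inverse (a z) * cnj (B z)) k = fcoef (\<lambda>z. inverse \<kappa> * (inverse (a z) * am z)) k"
      proof (rule fcoef_cong_AE)
        show "AE t in Tmeas. cnj (A (cis t)) + b (cis t) * inverse (a (cis t)) * cnj (B (cis t))
            = inverse \<kappa> * (inverse (a (cis t)) * am (cis t))"
          using ae pn anz
        proof eventually_elim
          case (elim t)
          have "a (cis t) * cnj (ap (cis t)) + b (cis t) * cnj (bp (cis t))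
             = am (cis t) * (ap (cis t) * cnj (ap (cis t)) + bp (cis t) * cnj (bp (cis t)))"
            unfolding conjunct1[OF elim(1)] conjunct2[OF elim(1)] by (simp add: algebra_simps)
          then have am_eq: "am (cis t) = a (cis t) * cnj (ap (cis t)) + b (cis t) * cnj (bp (cis t))" using elim(2) by simp
          show ?case unfolding am_eq using elim(3) \<kappa>0 cnj\<kappa> by (simp add: A_def B_def field_simps)
        qed
      qed (intro Linf_add Linf_mult Linf_const Linf_cnj LA LB Lr Li Lam)+
      also have "\<dots> = 0"
        unfolding fcoef_cmult using fcoef_mult_freq[OF Li Lam ifreq, of k] Lspace_freq_nonpos[OF m] that
        by (simp add: freq_nonpos_def)
      finally show ?thesis .
    qed
  qed
qed

section \<open>Stability of the system\<close>

text \<open>Cauchy-Schwarz in two dimensions, with the defect written as a square.\<close>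

lemma norm_sq_mult_diff_le:
  fixes x y z w :: complex
  shows "(cmod (x * y - z * w))\<^sup>2 \<le> ((cmod x)\<^sup>2 + (cmod z)\<^sup>2) * ((cmod y)\<^sup>2 + (cmod w)\<^sup>2)"
proof -
  have "cmod (x * y - z * w) \<le> cmod x * cmod y + cmod z * cmod w"
    using norm_triangle_ineq4[of "x * y" "z * w"] by (simp add: norm_mult)
  then have "(cmod (x * y - z * w))\<^sup>2 \<le> (cmod x * cmod y + cmod z * cmod w)\<^sup>2"
    by (rule power_mono) simp
  also have "\<dots> = ((cmod x)\<^sup>2 + (cmod z)\<^sup>2) * ((cmod y)\<^sup>2 + (cmod w)\<^sup>2) - (cmod x * cmod w - cmod z * cmod y)\<^sup>2"
    by (simp add: power2_eq_square algebra_simps)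
  also have "\<dots> \<le> ((cmod x)\<^sup>2 + (cmod z)\<^sup>2) * ((cmod y)\<^sup>2 + (cmod w)\<^sup>2)" by simp
  finally show ?thesis .
qed

text \<open>The constant 8 is 2 from the stability of the linear system times 4 from comparing
  \<open>r\<close> with \<open>r'\<close>.\<close>

lemma zero_coeff_lipschitz:
  assumes ab: "(a, b) \<in> Lspace" "1 / sqrt 2 \<le> inf_abs_Dstar a" "is_nlfs F (a, b)"
    and cd: "(c, d) \<in> Lspace" "1 / sqrt 2 \<le> inf_abs_Dstar c" "is_nlfs G (c, d)"
  shows "(cmod (F 0 - G 0))\<^sup>2 \<le> 8 * ((l2norm (\<lambda>z. a z - c z))\<^sup>2 + (l2norm (\<lambda>z. b z - d z))\<^sup>2)"
proof -
  obtain A B where A: "Linf A" "Linf B" "freq_nonpos A" "fcoef A 0 = 1"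
    "\<And>k. k < 0 \<Longrightarrow> fcoef B k = 0" "fcoef B 0 = F 0"
    "AE t in Tmeas. (cmod (A (cis t)))\<^sup>2 + (cmod (B (cis t)))\<^sup>2 \<le> 2"
    "\<And>k. k \<ge> 0 \<Longrightarrow> fcoef (\<lambda>z. B z - b z * inverse (a z) * A z) k = 0"
    "\<And>k. k > 0 \<Longrightarrow> fcoef (\<lambda>z. cnj (A z) + b z * inverse (a z) * cnj (B z)) k = 0"
    "Linf (\<lambda>z. inverse (a z))" "AE t in Tmeas. 1 / sqrt 2 \<le> cmod (a (cis t))"
    using riemann_hilbert[OF ab] by blast
  obtain A' B' where A': "Linf A'" "Linf B'" "freq_nonpos A'" "fcoef A' 0 = 1"
    "\<And>k. k < 0 \<Longrightarrow> fcoef B' k = 0" "fcoef B' 0 = G 0"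
    "AE t in Tmeas. (cmod (A' (cis t)))\<^sup>2 + (cmod (B' (cis t)))\<^sup>2 \<le> 2"
    "\<And>k. k \<ge> 0 \<Longrightarrow> fcoef (\<lambda>z. B' z - d z * inverse (c z) * A' z) k = 0"
    "\<And>k. k > 0 \<Longrightarrow> fcoef (\<lambda>z. cnj (A' z) + d z * inverse (c z) * cnj (B' z)) k = 0"
    "Linf (\<lambda>z. inverse (c z))" "AE t in Tmeas. 1 / sqrt 2 \<le> cmod (c (cis t))"
    using riemann_hilbert[OF cd] by blast
  note La = Lspace_Linf(1)[OF ab(1)] and Lb = Lspace_Linf(2)[OF ab(1)]
    and Lc = Lspace_Linf(1)[OF cd(1)] and Ld = Lspace_Linf(2)[OF cd(1)]
  define r r' where "r = (\<lambda>z. b z * inverse (a z))" and "r' = (\<lambda>z. d z * inverse (c z))"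
  have Lr: "Linf r" "Linf r'" unfolding r_def r'_def by (intro Linf_mult Lb Ld A(10) A'(10))+
  define \<delta>A \<delta>B s where "\<delta>A = (\<lambda>z. A z - A' z)" and "\<delta>B = (\<lambda>z. B z - B' z)" and "s = (\<lambda>z. r z - r' z)"
  define X where "X = (\<lambda>z. (B z - r z * A z) - (B' z - r' z * A' z))"
  define Y where "Y = (\<lambda>z. (cnj (A z) + r z * cnj (B z)) - (cnj (A' z) + r' z * cnj (B' z)))"
  \<comment> \<open>Since \<open>r * A - r' * A' = r * \<delta>A + s * A'\<close>, and similarly
    with \<open>cnj B\<close>, this collects the terms carrying \<open>s\<close>.\<close>
  define W where "W = (\<lambda>z. s z * (A' z * cnj (\<delta>B z) - \<delta>A z * cnj (B' z)))"
  have L\<delta>: "Linf \<delta>A" "Linf \<delta>B" and Ls: "Linf s" unfolding \<delta>A_def \<delta>B_def s_def by (intro Linf_diff A A' Lr)+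
  have LX: "Linf X" and LY: "Linf Y"
    unfolding X_def Y_def by (intro Linf_diff Linf_add Linf_mult Linf_cnj A(1,2) A'(1,2) Lr)+
  have LW: "Linf W" unfolding W_def by (intro Linf_diff Linf_mult Linf_cnj Ls L\<delta> A'(1,2))
  have Xk: "fcoef X k = 0" if "k \<ge> 0" for k
    using A(8)[OF that] A'(8)[OF that] unfolding X_def r_def r'_def
    by (subst fcoef_diff) (auto intro!: Linf_diff Linf_mult A(1,2,10) A'(1,2,10) Lb Ld)
  have Yk: "fcoef Y k = 0" if "k > 0" for k
    using A(9)[OF that] A'(9)[OF that] unfolding Y_def r_def r'_def
    by (subst fcoef_diff) (auto intro!: Linf_add Linf_mult Linf_cnj A(1,2,10) A'(1,2,10) Lb Ld)
  \<comment> \<open>The case \<open>k = 0\<close> comes from the common normalization. It matters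
    because \<open>Y\<close> may have a nonzero coefficient at 0.\<close>
  have \<delta>Ak: "fcoef \<delta>A k = 0" if "k \<ge> 0" for k
    unfolding \<delta>A_def fcoef_diff[OF A(1) A'(1)] using A(3,4) A'(3,4) that
    by (cases "k = 0") (auto simp: freq_nonpos_def)
  have \<delta>Bk: "fcoef \<delta>B k = 0" if "k < 0" for k
    unfolding \<delta>B_def fcoef_diff[OF A(2) A'(2)] using A(5) A'(5) that by simp
  have fcoef0: "fcoef f 0 = T_int f" for f by (simp add: fcoef_def)
  have X0: "T_int (\<lambda>z. cnj (\<delta>B z) * X z) = 0"
    unfolding fcoef0[symmetric]
    by (rule fcoef_mult_freq[OF Linf_cnj[OF L\<delta>(2)] LX]) (auto simp: freq_nonpos_def fcoef_cnj \<delta>Bk Xk)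
  have Y0: "T_int (\<lambda>z. Y z * \<delta>A z) = 0"
    unfolding fcoef0[symmetric]
    by (rule fcoef_mult_freq[OF LY L\<delta>(1)]) (auto simp: freq_nonpos_def \<delta>Ak Yk)
  txt \<open>The operator of the Riemann-Hilbert problem is the identity plus a skew-adjoint part, so the
    terms in \<open>r\<close> cancel here.\<close>
  have "T_int W = T_int (\<lambda>z. (\<delta>B z * cnj (\<delta>B z) + \<delta>A z * cnj (\<delta>A z)) - (cnj (\<delta>B z) * X z + Y z * \<delta>A z))"
    by (rule arg_cong[where f = T_int]) (simp add: W_def X_def Y_def \<delta>A_def \<delta>B_def s_def algebra_simps)
  also have "\<dots> = T_int (\<lambda>z. \<delta>B z * cnj (\<delta>B z) + \<delta>A z * cnj (\<delta>A z)) - T_int (\<lambda>z. cnj (\<delta>B z) * X z + Y z * \<delta>A z)"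
    by (rule T_int_diff) (intro Linf_add Linf_mult Linf_cnj L\<delta> LX LY)+
  also have "T_int (\<lambda>z. \<delta>B z * cnj (\<delta>B z) + \<delta>A z * cnj (\<delta>A z)) = T_int (\<lambda>z. \<delta>B z * cnj (\<delta>B z)) + T_int (\<lambda>z. \<delta>A z * cnj (\<delta>A z))"
    by (rule T_int_add) (intro Linf_add Linf_mult Linf_cnj L\<delta> LX LY)+
  also have "T_int (\<lambda>z. cnj (\<delta>B z) * X z + Y z * \<delta>A z) = T_int (\<lambda>z. cnj (\<delta>B z) * X z) + T_int (\<lambda>z. Y z * \<delta>A z)"
    by (rule T_int_add) (intro Linf_add Linf_mult Linf_cnj L\<delta> LX LY)+
  finally have "T_int W = of_real ((l2norm \<delta>B)\<^sup>2 + (l2norm \<delta>A)\<^sup>2)"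
    unfolding X0 Y0 T_int_self by simp
  then have "(l2norm \<delta>B)\<^sup>2 + (l2norm \<delta>A)\<^sup>2 = cmod (T_int W)" by (simp only: norm_of_real) simp
  \<comment> \<open>The weight 1/2 lets the last term be absorbed on the left, which produces the
    factor 2. It arises from \<open>x * y \<le> x\<^sup>2 + y\<^sup>2 / 4\<close> together with the
    bound 2 on \<open>A'\<close> and \<open>B'\<close>.\<close>
  also have "\<dots> \<le> 1 * (l2norm s)\<^sup>2 + 1/2 * ((l2norm \<delta>B)\<^sup>2 + (l2norm \<delta>A)\<^sup>2)"
  proof (rule T_int_sq_mono[OF LW Ls L\<delta>(2,1)])
    show "AE t in Tmeas. cmod (W (cis t)) \<le> 1 * (cmod (s (cis t)))\<^sup>2
        + 1/2 * ((cmod (\<delta>B (cis t)))\<^sup>2 + (cmod (\<delta>A (cis t)))\<^sup>2)"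
      using A'(7)
    proof eventually_elim
      case (elim t)
      define v where "v = A' (cis t) * cnj (\<delta>B (cis t)) - cnj (B' (cis t)) * \<delta>A (cis t)"
      have "(cmod v)\<^sup>2 \<le> ((cmod (A' (cis t)))\<^sup>2 + (cmod (B' (cis t)))\<^sup>2) * ((cmod (\<delta>B (cis t)))\<^sup>2 + (cmod (\<delta>A (cis t)))\<^sup>2)"
        using norm_sq_mult_diff_le[of "A' (cis t)" "cnj (\<delta>B (cis t))" "cnj (B' (cis t))" "\<delta>A (cis t)"] by (simp add: v_def)
      also have "\<dots> \<le> 2 * ((cmod (\<delta>B (cis t)))\<^sup>2 + (cmod (\<delta>A (cis t)))\<^sup>2)"
        using elim by (intro mult_right_mono) auto
      finally have v: "(cmod v)\<^sup>2 \<le> 2 * ((cmod (\<delta>B (cis t)))\<^sup>2 + (cmod (\<delta>A (cis t)))\<^sup>2)" .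
      have "cmod (W (cis t)) = cmod (s (cis t)) * cmod v" by (simp add: W_def v_def norm_mult mult.commute)
      also have "\<dots> \<le> (cmod (s (cis t)))\<^sup>2 + (cmod v)\<^sup>2 / 4"
        using zero_le_power2[of "cmod (s (cis t)) - cmod v / 2"] by (simp add: power2_eq_square field_simps)
      finally show ?case using v by linarith
    qed
  qed
  finally have \<delta>: "(l2norm \<delta>B)\<^sup>2 \<le> 2 * (l2norm s)\<^sup>2" using zero_le_power2[of "l2norm \<delta>A"] by argo
  have "complex_of_real ((l2norm s)\<^sup>2) = T_int (\<lambda>z. s z * cnj (s z))" by (rule T_int_self[symmetric])
  then have "(l2norm s)\<^sup>2 = cmod (T_int (\<lambda>z. s z * cnj (s z)))"
    by (metis abs_of_nonneg norm_of_real zero_le_power2)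
  \<comment> \<open>The factor 4 bounds the reciprocal of
    \<open>(cmod a0)\<^sup>2 * (cmod c0)\<^sup>2\<close>, both squares being at least 1/2.\<close>
  also have "\<dots> \<le> 0 * (l2norm s)\<^sup>2 + 4 * ((l2norm (\<lambda>z. a z - c z))\<^sup>2 + (l2norm (\<lambda>z. b z - d z))\<^sup>2)"
  proof (rule T_int_sq_mono)
    show "AE t in Tmeas. cmod (s (cis t) * cnj (s (cis t))) \<le> 0 * (cmod (s (cis t)))\<^sup>2
      + 4 * ((cmod (a (cis t) - c (cis t)))\<^sup>2 + (cmod (b (cis t) - d (cis t)))\<^sup>2)"
      using A(11) A'(11) Lspace_Linf(3)[OF cd(1)]
    proof eventually_elim
      case (elim t)
      define a0 b0 c0 d0 where "a0 = a (cis t)" and "b0 = b (cis t)" and "c0 = c (cis t)" and "d0 = d (cis t)"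
      have "complex_of_real ((cmod c0)\<^sup>2 + (cmod d0)\<^sup>2) = 1"
        using elim(3) by (simp add: complex_norm_square[symmetric] c0_def d0_def)
      then have 1: "(cmod c0)\<^sup>2 + (cmod d0)\<^sup>2 = 1" using of_real_eq_1_iff by blast
      have "(1 / sqrt 2)\<^sup>2 \<le> (cmod a0)\<^sup>2" "(1 / sqrt 2)\<^sup>2 \<le> (cmod c0)\<^sup>2"
        using elim by (auto intro!: power_mono simp: a0_def c0_def)
      then have half: "1 / 2 \<le> (cmod a0)\<^sup>2" "1 / 2 \<le> (cmod c0)\<^sup>2" by (simp_all add: power_divide)
      then have nz: "a0 \<noteq> 0" "c0 \<noteq> 0" by auto
      \<comment> \<open>Inserting \<open>c0 * d0\<close> makes \<open>c0\<close> and
        \<open>d0\<close> the coefficients, and they form a unit vector.\<close>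
      then have seq: "s (cis t) * (a0 * c0) = c0 * (b0 - d0) - d0 * (a0 - c0)"
        unfolding s_def r_def r'_def a0_def b0_def c0_def d0_def by (simp add: field_simps)
      have "(cmod (s (cis t)))\<^sup>2 * ((cmod a0)\<^sup>2 * (cmod c0)\<^sup>2) = (cmod (c0 * (b0 - d0) - d0 * (a0 - c0)))\<^sup>2"
        unfolding seq[symmetric] by (simp add: norm_mult power_mult_distrib)
      also have "\<dots> \<le> (cmod (b0 - d0))\<^sup>2 + (cmod (a0 - c0))\<^sup>2"
        using norm_sq_mult_diff_le[of c0 "b0 - d0" d0 "a0 - c0"] unfolding 1 by simp
      finally have 2: "(cmod (s (cis t)))\<^sup>2 * ((cmod a0)\<^sup>2 * (cmod c0)\<^sup>2) \<le> (cmod (b0 - d0))\<^sup>2 + (cmod (a0 - c0))\<^sup>2" .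
      have "(cmod (s (cis t)))\<^sup>2 * (1/2 * (1/2)) \<le> (cmod (s (cis t)))\<^sup>2 * ((cmod a0)\<^sup>2 * (cmod c0)\<^sup>2)"
        using half by (intro mult_left_mono mult_mono) auto
      with 2 show ?case by (simp add: norm_mult power2_eq_square a0_def b0_def c0_def d0_def)
    qed
  qed (intro Linf_mult Linf_cnj Linf_diff Ls La Lb Lc Ld)+
  finally have s: "(l2norm s)\<^sup>2 \<le> 4 * ((l2norm (\<lambda>z. a z - c z))\<^sup>2 + (l2norm (\<lambda>z. b z - d z))\<^sup>2)" by simp
  have "F 0 - G 0 = fcoef \<delta>B 0" unfolding \<delta>B_def fcoef_diff[OF A(2) A'(2)] A(6) A'(6) by simp
  then have "cmod (F 0 - G 0) \<le> l2norm \<delta>B" using fcoef_le_l2norm[OF L\<delta>(2), of 0] by simp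
  then have "(cmod (F 0 - G 0))\<^sup>2 \<le> (l2norm \<delta>B)\<^sup>2" by (rule power_mono) simp
  with \<delta> s show ?thesis by linarith
qed

text \<open>The value at infinity is a mean of a function of modulus at most 1. This caps
  \<open>\<epsilon>\<close> at \<open>1 - 1 / sqrt 2\<close>.\<close>

lemma inf_abs_Dstar_le_one:
  assumes "(a, b) \<in> Lspace" shows "inf_abs_Dstar a \<le> 1"
proof -
  have "(l2norm a)\<^sup>2 \<le> 1\<^sup>2" by (rule l2norm_sq_le_const[OF Lspace_Linf(1,4)[OF assms]])
  then have "l2norm a \<le> 1" by (rule power2_le_imp_le) simp
  then show ?thesis
    using inf_abs_Dstar_le(1)[of a] fcoef_le_l2norm[OF Lspace_Linf(1)[OF assms], of 0]
    unfolding at_inf_eq_fcoef by linarith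
qed

theorem theorem7p5:
  fixes \<epsilon> :: real and a b c d :: "complex \<Rightarrow> complex" and F G :: "int \<Rightarrow> complex"
  assumes "\<epsilon> > 0"
    and "(a, b) \<in> Beps \<epsilon>" and "(c, d) \<in> Beps \<epsilon>"
    and "l2seq F" and "is_nlfs F (a, b)"
    and "l2seq G" and "is_nlfs G (c, d)"
  shows "cmod (F 0 - G 0)
         \<le> (8 + 2 powr (5/2)) * ((3 powr (3/2) / 2) * \<epsilon>) powr (-3/2)
            * Hnorm (\<lambda>z. a z - c z, \<lambda>z. b z - d z)"
proof -
  have ab: "(a, b) \<in> Lspace" "1 / sqrt 2 + \<epsilon> \<le> inf_abs_Dstar a"
    and cd: "(c, d) \<in> Lspace" "1 / sqrt 2 + \<epsilon> \<le> inf_abs_Dstar c"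
    using assms(2,3) by (auto simp: Beps_def Bspace_def)
  define H where "H = Hnorm (\<lambda>z. a z - c z, \<lambda>z. b z - d z)"
  have H: "H \<ge> 0" "H\<^sup>2 = (l2norm (\<lambda>z. a z - c z))\<^sup>2 + (l2norm (\<lambda>z. b z - d z))\<^sup>2"
    by (simp_all add: H_def Hnorm_def)
  have "(cmod (F 0 - G 0))\<^sup>2 \<le> 8 * H\<^sup>2"
    unfolding H(2) by (rule zero_coeff_lipschitz) (use ab cd assms in auto)
  \<comment> \<open>The constant \<open>sqrt 8\<close> is enlarged to 8, the first summand of the
    claimed factor.\<close>
  also have "\<dots> \<le> (8 * H)\<^sup>2" by (simp add: power_mult_distrib)
  finally have "cmod (F 0 - G 0) \<le> 8 * H"
    by (rule power2_le_imp_le) (use H(1) in simp)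
  also have "8 * H \<le> (8 + 2 powr (5/2)) * ((3 powr (3/2) / 2) * \<epsilon>) powr (-3/2) * H"
  proof (rule mult_right_mono[OF _ H(1)])
    \<comment> \<open>Once \<open>x \<le> 1\<close>, the negative power of \<open>x\<close> is at
      least 1, so the claimed constant is at least 8.\<close>
    define x where "x = (3 powr (3/2) / 2) * \<epsilon>"
    have "x \<le> 1"
    proof -
      \<comment> \<open>\<open>sqrt 2 \<ge> 1.4\<close> gives \<open>\<epsilon> \<le> 0.3\<close>,
        and \<open>sqrt 3 \<le> 2\<close> bounds the coefficient of \<open>\<epsilon>\<close> by 3,
        so \<open>x \<le> 0.9\<close>.\<close>
      have "(1.4::real) \<le> sqrt 2" by (rule real_le_rsqrt) (simp add: power2_eq_square)
      moreover have "sqrt 3 \<le> (2::real)" by (rule real_le_lsqrt) auto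
      moreover have "1 / sqrt 2 = sqrt 2 / (2::real)" by (simp add: field_simps)
      ultimately have "\<epsilon> \<le> 0.3" using ab(2) inf_abs_Dstar_le_one[OF ab(1)] by simp
      have "3 powr (3/2) = 3 powr 1 * 3 powr (1/2 :: real)" by (subst powr_add[symmetric]) simp
      also have "\<dots> = 3 * sqrt 3" by (simp add: powr_half_sqrt)
      finally have "x \<le> 3 * \<epsilon>" using \<open>sqrt 3 \<le> 2\<close> assms(1) unfolding x_def by (intro mult_right_mono) auto
      with \<open>\<epsilon> \<le> 0.3\<close> show ?thesis by simp
    qed
    moreover have "x > 0" using assms(1) by (simp add: x_def)
    ultimately have "x powr 0 \<le> x powr (-3/2)" by (intro powr_mono') auto
    then have "1 \<le> x powr (-3/2)" using \<open>x > 0\<close> by simp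
    then have "8 * 1 \<le> (8 + 2 powr (5/2)) * x powr (-3/2)" by (intro mult_mono) auto
    then show "8 \<le> (8 + 2 powr (5/2)) * ((3 powr (3/2) / 2) * \<epsilon>) powr (-3/2)" by (simp add: x_def)
  qed
  finally show ?thesis unfolding H_def .
qed

end
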